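(* With conditions (1)–(7) below on a quasilocal integral domain $(D,M)$: (1) $D$ is a local API-domain; (2) $D$ is a Noetherian AV-domain; (3) $D$ is an AV-domain and for each ideal $A$ with $0\subsetneq A\subsetneq D$ there is $n$ with $M^n\subseteq A$; (4) $D$ is an AV-domain with $\overline{D}$ a DVR; (5) $D$ is an AV-domain with $\bigcap_{n\ge1}M^n=0$; (6) $D$ is a quasilocal API-domain; (7) $D$ is a RAV-domain, the following hold: there exists a quasilocal domain satisfying (2) but not (6); there exists one satisfying (6) but not (2); there exists one satisfying (3) but not (2); there exists one satisfying (4) but not (2); and there exists one satisfying (7) but not (5).
   Context: Quasilocal: unique maximal ideal; local: Noetherian and quasilocal. $\overline{D}$ is the integral closure in the quotient field. AV-domain: for nonzero $a,b$ there is $n$ with $a^n\mid b^n$ or $b^n\mid a^n$. API-domain: for every nonempty subset $\{d_\alpha\}$ of nonzero elements there is $n$ with $(\{d_\alpha^n\})$ principal. DVR: local PID not a field. For a domain $D$ not a field, an almost uniformizing parameter is $a\in D$ such that every nonzero nonunit $y$ satisfies $y^m=ua^n$ for some natural numbers $m,n$ and unit $u$; a RAV-domain is a domain having one. *)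

theory Defs
  imports "HOL-Algebra.Algebra"
begin

definition quasilocal :: "('a, 'b) ring_scheme \<Rightarrow> bool" where
  "quasilocal R \<longleftrightarrow> domain R \<and> (\<exists>!M. maximalideal M R)"

definition qmax :: "('a, 'b) ring_scheme \<Rightarrow> 'a set" where
  "qmax R = (THE M. maximalideal M R)"

definition is_local :: "('a, 'b) ring_scheme \<Rightarrow> bool" where
  "is_local R \<longleftrightarrow> noetherian_ring R \<and> quasilocal R"

fun ideal_pow :: "('a, 'b) ring_scheme \<Rightarrow> 'a set \<Rightarrow> nat \<Rightarrow> 'a set" where
  "ideal_pow R A 0 = carrier R"
| "ideal_pow R A (Suc n) = ideal_prod R A (ideal_pow R A n)"

definition AV_domain :: "('a, 'b) ring_scheme \<Rightarrow> bool" where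
  "AV_domain R \<longleftrightarrow> domain R \<and>
     (\<forall>a \<in> carrier R - {\<zero>\<^bsub>R\<^esub>}. \<forall>b \<in> carrier R - {\<zero>\<^bsub>R\<^esub>}. \<exists>n::nat. n > 0 \<and>
        (a [^]\<^bsub>R\<^esub> n divides\<^bsub>R\<^esub> b [^]\<^bsub>R\<^esub> n \<or> b [^]\<^bsub>R\<^esub> n divides\<^bsub>R\<^esub> a [^]\<^bsub>R\<^esub> n))"

definition API_domain :: "('a, 'b) ring_scheme \<Rightarrow> bool" where
  "API_domain R \<longleftrightarrow> domain R \<and>
     (\<forall>S. S \<noteq> {} \<and> S \<subseteq> carrier R - {\<zero>\<^bsub>R\<^esub>} \<longrightarrow>
        (\<exists>n::nat. n > 0 \<and> principalideal (Idl\<^bsub>R\<^esub> ((\<lambda>d. d [^]\<^bsub>R\<^esub> n) ` S)) R))"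

definition DVR :: "('a, 'b) ring_scheme \<Rightarrow> bool" where
  "DVR R \<longleftrightarrow> is_local R \<and> principal_domain R \<and> \<not> field R"

definition integral_over :: "('a, 'b) ring_scheme \<Rightarrow> 'a set \<Rightarrow> 'a \<Rightarrow> bool" where
  "integral_over K S x \<longleftrightarrow> (\<exists>n::nat. \<exists>c::nat \<Rightarrow> 'a. (\<forall>i<n. c i \<in> S) \<and>
      x [^]\<^bsub>K\<^esub> n \<oplus>\<^bsub>K\<^esub> (\<Oplus>\<^bsub>K\<^esub>i\<in>{..<n}. c i \<otimes>\<^bsub>K\<^esub> x [^]\<^bsub>K\<^esub> i) = \<zero>\<^bsub>K\<^esub>)"

definition quotient_field_of :: "('a, 'b) ring_scheme \<Rightarrow> ('c, 'd) ring_scheme \<Rightarrow> ('a \<Rightarrow> 'c) \<Rightarrow> bool" where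
  "quotient_field_of R K h \<longleftrightarrow> domain R \<and> field K \<and> h \<in> ring_hom R K \<and> inj_on h (carrier R) \<and>
     (\<forall>x \<in> carrier K. \<exists>a \<in> carrier R. \<exists>b \<in> carrier R. b \<noteq> \<zero>\<^bsub>R\<^esub> \<and>
        x = h a \<otimes>\<^bsub>K\<^esub> inv\<^bsub>K\<^esub> (h b))"

definition integral_closure_in :: "'c ring \<Rightarrow> ('a \<Rightarrow> 'c) \<Rightarrow> ('a, 'b) ring_scheme \<Rightarrow> 'c ring" where
  "integral_closure_in K h R = K\<lparr>carrier := {x \<in> carrier K. integral_over K (h ` carrier R) x}\<rparr>"

(* \<overline>D is a DVR (quotient field unique up to isomorphism; we take a quotient field on the same carrier type) *)
definition closure_is_DVR :: "'a ring \<Rightarrow> bool" where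
  "closure_is_DVR R \<longleftrightarrow> (\<exists>(K::'a ring) h. quotient_field_of R K h \<and> DVR (integral_closure_in K h R))"

definition RAV_domain :: "('a, 'b) ring_scheme \<Rightarrow> bool" where
  "RAV_domain R \<longleftrightarrow> domain R \<and> \<not> field R \<and>
     (\<exists>a \<in> carrier R. \<forall>y \<in> carrier R - {\<zero>\<^bsub>R\<^esub>} - Units R.
        \<exists>(m::nat) (n::nat). \<exists>u \<in> Units R. m > 0 \<and> n > 0 \<and> y [^]\<^bsub>R\<^esub> m = u \<otimes>\<^bsub>R\<^esub> a [^]\<^bsub>R\<^esub> n)"

definition cond2 :: "'a ring \<Rightarrow> bool" where
  "cond2 R \<longleftrightarrow> noetherian_ring R \<and> AV_domain R"

definition cond3 :: "'a ring \<Rightarrow> bool" where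
  "cond3 R \<longleftrightarrow> AV_domain R \<and>
     (\<forall>A. ideal A R \<and> A \<noteq> {\<zero>\<^bsub>R\<^esub>} \<and> A \<noteq> carrier R \<longrightarrow> (\<exists>n::nat. ideal_pow R (qmax R) n \<subseteq> A))"

definition cond4 :: "'a ring \<Rightarrow> bool" where
  "cond4 R \<longleftrightarrow> AV_domain R \<and> closure_is_DVR R"

definition cond5 :: "'a ring \<Rightarrow> bool" where
  "cond5 R \<longleftrightarrow> AV_domain R \<and> (\<Inter>n\<in>{1..}. ideal_pow R (qmax R) n) = {\<zero>\<^bsub>R\<^esub>}"

definition cond6 :: "'a ring \<Rightarrow> bool" where
  "cond6 R \<longleftrightarrow> quasilocal R \<and> API_domain R"

definition cond7 :: "'a ring \<Rightarrow> bool" where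
  "cond7 R \<longleftrightarrow> RAV_domain R"

end

theory Submission
  imports Defs "HOL-Algebra.Algebraic_Closure_Type" "HOL-Library.Z2" "HOL-Library.Poly_Mapping"
    "HOL-Computational_Algebra.Formal_Laurent_Series" "HOL-Computational_Algebra.Fraction_Field"
begin

text \<open>
  For fields \<open>k \<subseteq> L\<close> let \<open>D = k + x L[[x]]\<close>, a quasilocal domain with quotient field \<open>L((x))\<close>.
  Divisibility in \<open>D\<close> between elements of different order is automatic, so everything is decided by
  the quotients of leading coefficients: \<open>D\<close> is an AV-domain if \<open>L\<^sup>*/k\<^sup>*\<close> is torsion, and an
  API-domain iff \<open>L\<^sup>*/k\<^sup>*\<close> has finite exponent, while it is Noetherian iff \<open>[L : k]\<close> is finite.

  (2) without (6): \<open>L\<close> is the union of the fields with \<open>4^m\<close> elements and \<open>k\<close> the union of the fields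
  with \<open>2^m\<close> elements, for odd \<open>m\<close>. Then \<open>L = k(\<omega>)\<close> with \<open>\<omega>\<^sup>2 = \<omega> + 1\<close> is torsion modulo
  \<open>k\<^sup>*\<close>; an exponent \<open>n\<close> would give \<open>(\<omega> + 1 + c)^n = (\<omega> + c)^n\<close> for the infinitely many \<open>c\<close> in
  \<open>k\<close>, by applying a Frobenius power that fixes \<open>c\<close> and moves \<open>\<omega>\<close> to \<open>\<omega> + 1\<close>.

  (6), (3), (4) without (2): \<open>L\<close> is the field of rational functions over \<open>\<bbbF>\<^sub>2\<close> in infinitely many
  indeterminates and \<open>k = L\<^sup>2\<close>, so that the exponent is 2 and the degree is infinite.

  (7) without (5): in the perfect closure of \<open>\<bbbF>\<^sub>2[[x]]\<close> the element \<open>x\<close> is an almost uniformizing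
  parameter, but every element of the maximal ideal \<open>M\<close> is a square, so \<open>M = M\<^sup>2\<close>.
\<close>

section \<open>Copies of a subring of an integral domain on another type\<close>

text \<open>
  \<open>\<psi>\<close> decodes \<open>\<phi>\<close> on \<open>D\<close>. Keeping \<open>\<psi>\<close> independent of \<open>D\<close> makes the copies of a subring and of its overrings
  differ in the carrier only, as the definition of the integral closure requires.
\<close>

definition copy :: "('a::idom \<Rightarrow> 'c) \<Rightarrow> ('c \<Rightarrow> 'a) \<Rightarrow> 'a set \<Rightarrow> 'c ring" where
  "copy \<phi> \<psi> D = \<lparr>carrier = \<phi> ` D, monoid.mult = (\<lambda>x y. \<phi> (\<psi> x * \<psi> y)), one = \<phi> 1,
     ring.zero = \<phi> 0, ring.add = (\<lambda>x y. \<phi> (\<psi> x + \<psi> y))\<rparr>"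

locale transported_subring =
  fixes \<phi> :: "'a::idom \<Rightarrow> 'c" and \<psi> :: "'c \<Rightarrow> 'a" and D :: "'a set"
  assumes decode [simp]: "d \<in> D \<Longrightarrow> \<psi> (\<phi> d) = d"
    and zero_mem [simp]: "0 \<in> D" and one_mem [simp]: "1 \<in> D"
    and add_mem [simp]: "a \<in> D \<Longrightarrow> b \<in> D \<Longrightarrow> a + b \<in> D"
    and mult_mem [simp]: "a \<in> D \<Longrightarrow> b \<in> D \<Longrightarrow> a * b \<in> D"
    and uminus_mem [simp]: "a \<in> D \<Longrightarrow> - a \<in> D"
begin

abbreviation "R \<equiv> copy \<phi> \<psi> D"

lemma carrier_copy: "carrier R = \<phi> ` D"
  by (simp add: copy_def)

lemma copy_simps [simp]:
  "\<one>\<^bsub>R\<^esub> = \<phi> 1" "\<zero>\<^bsub>R\<^esub> = \<phi> 0"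
  "a \<in> D \<Longrightarrow> b \<in> D \<Longrightarrow> \<phi> a \<otimes>\<^bsub>R\<^esub> \<phi> b = \<phi> (a * b)"
  "a \<in> D \<Longrightarrow> b \<in> D \<Longrightarrow> \<phi> a \<oplus>\<^bsub>R\<^esub> \<phi> b = \<phi> (a + b)"
  by (simp_all add: copy_def)

lemma phi_eq_iff [simp]: "a \<in> D \<Longrightarrow> b \<in> D \<Longrightarrow> \<phi> a = \<phi> b \<longleftrightarrow> a = b"
  by (metis decode)

lemma phi_mem_iff [simp]: "B \<subseteq> D \<Longrightarrow> a \<in> D \<Longrightarrow> \<phi> a \<in> \<phi> ` B \<longleftrightarrow> a \<in> B"
  by (auto dest: subsetD)

lemma phi_image_subset_iff: "A \<subseteq> D \<Longrightarrow> B \<subseteq> D \<Longrightarrow> \<phi> ` A \<subseteq> \<phi> ` B \<longleftrightarrow> A \<subseteq> B"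
proof
  assume *: "A \<subseteq> D" "B \<subseteq> D" "\<phi> ` A \<subseteq> \<phi> ` B"
  show "A \<subseteq> B"
  proof
    fix a assume "a \<in> A"
    then have "a \<in> D" "\<phi> a \<in> \<phi> ` B" using * by auto
    with *(2) show "a \<in> B" by simp
  qed
qed auto

lemma phi_carrier [simp]: "a \<in> D \<Longrightarrow> \<phi> a \<in> carrier R"
  by (simp add: carrier_copy)

lemma power_mem [simp]: "a \<in> D \<Longrightarrow> a ^ n \<in> D"
  by (induction n) auto

sublocale domain R
proof (intro domainI cringI abelian_groupI comm_monoidI)
  fix x assume "x \<in> carrier R"
  then obtain a where "a \<in> D" "x = \<phi> a" by (auto simp: carrier_copy)
  then show "\<exists>y\<in>carrier R. y \<oplus>\<^bsub>R\<^esub> x = \<zero>\<^bsub>R\<^esub>"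
    by (intro bexI[of _ "\<phi> (- a)"]) auto
qed (auto simp: carrier_copy algebra_simps)

lemma domain_copy: "domain R" ..

lemma pow_copy [simp]: "a \<in> D \<Longrightarrow> \<phi> a [^]\<^bsub>R\<^esub> (n::nat) = \<phi> (a ^ n)"
  by (induction n) (auto simp: mult.commute)

lemma divides_copy [simp]:
  "a \<in> D \<Longrightarrow> b \<in> D \<Longrightarrow> \<phi> a divides\<^bsub>R\<^esub> \<phi> b \<longleftrightarrow> (\<exists>c\<in>D. b = a * c)"
  by (auto simp: factor_def carrier_copy)

lemma Units_copy: "Units R = \<phi> ` {a \<in> D. \<exists>b\<in>D. a * b = 1}"
  by (auto simp: Units_def carrier_copy mult.commute) 

lemma finsum_copy: "(\<And>i. i \<in> I \<Longrightarrow> f i \<in> D) \<Longrightarrow> (\<Oplus>\<^bsub>R\<^esub>i\<in>I. \<phi> (f i)) = \<phi> (sum f I) \<and> sum f I \<in> D"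
  by (induction I rule: infinite_finite_induct) (auto simp: Pi_def)

section \<open>Ideals of the copy, seen as subsets of the original ring\<close>

definition abs_ideal :: "'a set \<Rightarrow> bool" where
  "abs_ideal B \<longleftrightarrow> B \<subseteq> D \<and> 0 \<in> B \<and> (\<forall>a\<in>B. \<forall>b\<in>B. a + b \<in> B) \<and> (\<forall>d\<in>D. \<forall>a\<in>B. d * a \<in> B)"

lemma abs_ideal_iff: "B \<subseteq> D \<Longrightarrow> ideal (\<phi> ` B) R \<longleftrightarrow> abs_ideal B"
proof
  assume BD: "B \<subseteq> D" and "ideal (\<phi> ` B) R"
  then interpret I: ideal "\<phi> ` B" R by simp
  have mem: "b \<in> D" if "b \<in> B" for b using that BD by auto
  show "abs_ideal B"
    unfolding abs_ideal_def
  proof (intro conjI ballI BD)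
    show "0 \<in> B" using I.zero_closed BD by simp
  next
    fix a b assume "a \<in> B" "b \<in> B"
    then show "a + b \<in> B" using I.a_closed[of "\<phi> a" "\<phi> b"] BD by (simp add: mem)
  next
    fix d a assume "d \<in> D" "a \<in> B"
    then show "d * a \<in> B" using I.I_l_closed[of "\<phi> a" "\<phi> d"] BD by (simp add: mem)
  qed
next
  assume BD: "B \<subseteq> D" and B: "abs_ideal B"
  \<comment> \<open>Negatives come from multiplication by \<open>- 1\<close>, which lies in
    \<open>D\<close>.\<close>
  have neg: "- a \<in> B" if "a \<in> B" for a
    using B that one_mem uminus_mem unfolding abs_ideal_def by (metis mult_minus1)
  show "ideal (\<phi> ` B) R"
  proof (rule idealI)
    show "ring R" by (rule ring_axioms)
    show "subgroup (\<phi> ` B) (add_monoid R)"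
    proof (rule group.subgroupI)
      show "Group.group (add_monoid R)" using a_group by simp
      fix x assume "x \<in> \<phi> ` B"
      then obtain a where a: "a \<in> B" "x = \<phi> a" by auto
      have "inv\<^bsub>add_monoid R\<^esub> x = \<phi> (- a)"
        using a BD minus_equality[of "\<phi> (- a)" "\<phi> a"] by (auto simp: a_inv_def subset_iff)
      then show "inv\<^bsub>add_monoid R\<^esub> x \<in> \<phi> ` B" using a neg by simp
    qed (use B BD in \<open>auto simp: abs_ideal_def carrier_copy subset_iff\<close>)
    have mult: "\<phi> d \<otimes>\<^bsub>R\<^esub> \<phi> a \<in> \<phi> ` B" "\<phi> a \<otimes>\<^bsub>R\<^esub> \<phi> d \<in> \<phi> ` B" if "a \<in> B" "d \<in> D" for a d
      using B BD that by (auto simp: abs_ideal_def subset_iff mult.commute[of a])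
    show "x \<otimes>\<^bsub>R\<^esub> a \<in> \<phi> ` B" "a \<otimes>\<^bsub>R\<^esub> x \<in> \<phi> ` B" if "a \<in> \<phi> ` B" "x \<in> carrier R" for a x
      using that mult unfolding carrier_copy by blast+
  qed
qed

lemma idealE:
  assumes "ideal A R"
  obtains B where "abs_ideal B" "B \<subseteq> D" "A = \<phi> ` B"
proof -
  have "A \<subseteq> \<phi> ` D" using ideal.Icarr[OF assms] by (auto simp: carrier_copy)
  then obtain B where "B \<subseteq> D" "A = \<phi> ` B" by (metis subset_image_iff)
  with assms abs_ideal_iff show ?thesis using that by blast
qed

text \<open>Every ideal of the copy is the image of an \<open>abs_ideal\<close>, so minimality need
  only be tested inside \<open>D\<close>.\<close>

lemma Idl_eqI:
  assumes "abs_ideal B" "S \<subseteq> B" "\<And>C. abs_ideal C \<Longrightarrow> S \<subseteq> C \<Longrightarrow> B \<subseteq> C"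
  shows "Idl\<^bsub>R\<^esub> (\<phi> ` S) = \<phi> ` B"
proof (rule equalityI)
  have BD: "B \<subseteq> D" using assms(1) by (simp add: abs_ideal_def)
  show "Idl\<^bsub>R\<^esub> (\<phi> ` S) \<subseteq> \<phi> ` B"
    using assms BD by (intro genideal_minimal) (auto simp: abs_ideal_iff)
  have carr: "\<phi> ` S \<subseteq> carrier R" using assms(2) BD by auto
  obtain C where C: "abs_ideal C" "C \<subseteq> D" "Idl\<^bsub>R\<^esub> (\<phi> ` S) = \<phi> ` C"
    using idealE genideal_ideal[OF carr] by metis
  have "S \<subseteq> C"
    using genideal_self[OF carr] C assms(2) BD phi_mem_iff unfolding C(3) by blast
  then show "\<phi> ` B \<subseteq> Idl\<^bsub>R\<^esub> (\<phi> ` S)" using assms(3) C by auto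
qed

lemma Idl_subset:
  assumes "abs_ideal B" "S \<subseteq> B"
  shows "Idl\<^bsub>R\<^esub> (\<phi> ` S) \<subseteq> \<phi> ` B"
  using assms by (intro genideal_minimal) (auto simp: abs_ideal_iff abs_ideal_def)

lemma abs_ideal_principal: "g \<in> D \<Longrightarrow> abs_ideal {g * d | d. d \<in> D}"
  unfolding abs_ideal_def
proof (intro conjI ballI)
  show "0 \<in> {g * d | d. d \<in> D}" by (auto intro!: exI[of _ 0])
next
  fix a b assume "a \<in> {g * d | d. d \<in> D}" "b \<in> {g * d | d. d \<in> D}"
  then show "a + b \<in> {g * d | d. d \<in> D}" by (auto simp flip: distrib_left)
next
  fix e a assume "e \<in> D" "a \<in> {g * d | d. d \<in> D}"
  then obtain d where "a = g * d" "d \<in> D" by auto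
  then show "e * a \<in> {g * d | d. d \<in> D}" using \<open>e \<in> D\<close> 
    by (auto intro!: exI[of _ "e * d"])
qed auto

lemma Idl_singleton: "g \<in> D \<Longrightarrow> Idl\<^bsub>R\<^esub> {\<phi> g} = \<phi> ` {g * d | d. d \<in> D}"
proof -
  assume g: "g \<in> D"
  have "g = g * 1" by simp
  then have "{g} \<subseteq> {g * d | d. d \<in> D}" using one_mem by blast
  then show ?thesis
    using Idl_eqI[of "{g * d | d. d \<in> D}" "{g}"] abs_ideal_principal[OF g]
    by (auto simp: abs_ideal_def mult.commute)
qed

section \<open>Criteria for AV-domains, quasilocal rings and API-domains\<close>

lemma AV_domainI:
  assumes "\<And>a b. a \<in> D \<Longrightarrow> b \<in> D \<Longrightarrow> a \<noteq> 0 \<Longrightarrow> b \<noteq> 0 \<Longrightarrow>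
    \<exists>n>0. (\<exists>c\<in>D. b ^ n = a ^ n * c) \<or> (\<exists>c\<in>D. a ^ n = b ^ n * c)"
  shows "AV_domain R"
  unfolding AV_domain_def carrier_copy
proof (intro conjI ballI domain_copy)
  fix x y assume "x \<in> \<phi> ` D - {\<zero>\<^bsub>R\<^esub>}" "y \<in> \<phi> ` D - {\<zero>\<^bsub>R\<^esub>}"
  then obtain a b where "a \<in> D" "b \<in> D" "x = \<phi> a" "y = \<phi> b" "a \<noteq> 0" "b \<noteq> 0" by auto
  then show "\<exists>n::nat. n > 0 \<and> (x [^]\<^bsub>R\<^esub> n divides\<^bsub>R\<^esub> y [^]\<^bsub>R\<^esub> n \<or> y [^]\<^bsub>R\<^esub> n divides\<^bsub>R\<^esub> x [^]\<^bsub>R\<^esub> n)"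
    using assms[of a b] by simp
qed

text \<open>If sums of nonunits are nonunits, the nonunits form an ideal. A proper ideal contains no
  unit, so it lies in this one, which is therefore the only maximal ideal.\<close>

lemma
  assumes add: "\<And>a b. a \<in> D \<Longrightarrow> b \<in> D \<Longrightarrow> \<forall>d\<in>D. a * d \<noteq> 1 \<Longrightarrow> \<forall>d\<in>D. b * d \<noteq> 1 \<Longrightarrow> 
      \<forall>d\<in>D. (a + b) * d \<noteq> 1"
  shows quasilocalI: "quasilocal R"
    and qmax_eq: "qmax R = \<phi> ` {a\<in>D. \<forall>d\<in>D. a * d \<noteq> 1}"
proof -
  define M where "M = {a\<in>D. \<forall>d\<in>D. a * d \<noteq> 1}"
  have MD: "M \<subseteq> D" by (auto simp: M_def)
  have "abs_ideal M"
    unfolding abs_ideal_def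
  proof (intro conjI ballI MD)
    show "0 \<in> M" by (simp add: M_def)
    fix a b assume "a \<in> M" "b \<in> M" then show "a + b \<in> M" using add by (simp add: M_def)
  next
    fix d a assume "d \<in> D" "a \<in> M" then show "d * a \<in> M" 
    proof -
      have "d * a * e \<noteq> 1" if "e \<in> D" for e
      proof
        assume "d * a * e = 1"
        then have "a * (d * e) = 1" by (simp add: mult_ac)
        with \<open>a \<in> M\<close> \<open>d \<in> D\<close> that show False by (simp add: M_def)
      qed
      with \<open>d \<in> D\<close> \<open>a \<in> M\<close> show ?thesis by (simp add: M_def)
    qed
  qed
  then have idM: "ideal (\<phi> ` M) R" using MD by (simp add: abs_ideal_iff)
  have neqM: "carrier R \<noteq> \<phi> ` M"
  proof
    assume "carrier R = \<phi> ` M"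
    then have "\<phi> 1 \<in> \<phi> ` M" using phi_carrier[OF one_mem] by simp
    then have "1 \<in> M" using MD by simp
    then show False by (auto simp: M_def)
  qed
  have sub: "J \<subseteq> \<phi> ` M" if J: "ideal J R" "J \<noteq> carrier R" for J
  proof -
    obtain B where B: "abs_ideal B" "B \<subseteq> D" "J = \<phi> ` B" using J(1) by (rule idealE)
    have "B \<subseteq> M"
    proof
      fix b assume b: "b \<in> B"
      have "b * d \<noteq> 1" if d: "d \<in> D" for d
      proof
        assume "b * d = 1"
        moreover have "d * b \<in> B" using B(1) b d unfolding abs_ideal_def by blast
        ultimately have "1 \<in> B" by (simp add: mult.commute)
        with B(1) have "d * 1 \<in> B" if "d \<in> D" for d using that unfolding abs_ideal_def by blast
        then have "D \<subseteq> B" by auto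
        with B J show False by (auto simp: carrier_copy)
      qed
      with b B(2) show "b \<in> M" by (auto simp: M_def)
    qed
    with B show ?thesis by auto
  qed
  have maxM: "maximalideal (\<phi> ` M) R"
  proof (rule maximalidealI[OF idM neqM])
    fix J assume "ideal J R" "\<phi> ` M \<subseteq> J"
    then show "J = \<phi> ` M \<or> J = carrier R" using sub[of J] by auto
  qed
  have uniq: "J = \<phi> ` M" if "maximalideal J R" for J
  proof -
    interpret maximalideal J R by fact
    have "\<phi> ` M \<subseteq> carrier R" using MD by auto
    then show ?thesis using I_maximal[OF idM] sub[OF is_ideal] I_notcarr neqM by auto
  qed
  show "quasilocal R" unfolding quasilocal_def using domain_copy ex1I[of "\<lambda>M. maximalideal M R", OF maxM uniq] by simp
  show "qmax R = \<phi> ` {a\<in>D. \<forall>d\<in>D. a * d \<noteq> 1}"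
    unfolding qmax_def M_def[symmetric] using maxM uniq by (rule the_equality)
qed

lemma pow_image: "S \<subseteq> D \<Longrightarrow> (\<lambda>x. x [^]\<^bsub>R\<^esub> (n::nat)) ` \<phi> ` S = \<phi> ` (\<lambda>s. s ^ n) ` S"
  unfolding image_image by (intro image_cong) auto

text \<open>An \<open>s\<close> whose \<open>n\<close>-th power divides all the others generates the
  ideal of \<open>n\<close>-th powers by itself.\<close>

lemma API_domainI:
  assumes "\<And>S. S \<noteq> {} \<Longrightarrow> S \<subseteq> D - {0} \<Longrightarrow> \<exists>n>0. \<exists>s\<in>S. \<forall>t\<in>S. \<exists>c\<in>D. t ^ n = s ^ n * c"
  shows "API_domain R"
  unfolding API_domain_def
proof (intro conjI allI impI domain_copy)
  fix T assume T: "T \<noteq> {} \<and> T \<subseteq> carrier R - {\<zero>\<^bsub>R\<^esub>}"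
  then have "T \<subseteq> \<phi> ` D" by (auto simp: carrier_copy)
  then obtain S where S: "S \<subseteq> D" "T = \<phi> ` S" by (metis subset_image_iff)
  moreover have "0 \<notin> S" using T S by auto
  ultimately obtain n s where n: "n > 0" "s \<in> S" "\<forall>t\<in>S. \<exists>c\<in>D. t ^ n = s ^ n * c"
    using assms[of S] T by blast
  have "s \<in> D" using n S by auto
  have "Idl\<^bsub>R\<^esub> (\<phi> ` (\<lambda>s. s ^ n) ` S) = \<phi> ` {s ^ n * d | d. d \<in> D}"
    using n \<open>s \<in> D\<close> 
    by (intro Idl_eqI abs_ideal_principal) (auto simp: abs_ideal_def mult.commute[of "s ^ n"])
  also have "\<dots> = Idl\<^bsub>R\<^esub> {\<phi> (s ^ n)}"
    using \<open>s \<in> D\<close> by (simp add: Idl_singleton)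
  finally have "Idl\<^bsub>R\<^esub> ((\<lambda>d. d [^]\<^bsub>R\<^esub> n) ` T) = Idl\<^bsub>R\<^esub> {\<phi> (s ^ n)}"
    using S by (simp add: pow_image)
  moreover have "principalideal (Idl\<^bsub>R\<^esub> {\<phi> (s ^ n)}) R"
    using \<open>s \<in> D\<close> by (intro principalidealI genideal_ideal) auto
  ultimately show "\<exists>n::nat. n > 0 \<and> principalideal (Idl\<^bsub>R\<^esub> ((\<lambda>d. d [^]\<^bsub>R\<^esub> n) ` T)) R"
    using n by auto
qed

lemma API_domainE:
  assumes "API_domain R" "S \<noteq> {}" "S \<subseteq> D - {0}"
  obtains n g where "n > 0" "g \<in> D" "Idl\<^bsub>R\<^esub> (\<phi> ` (\<lambda>s. s ^ n) ` S) = \<phi> ` {g * d | d. d \<in> D}"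
proof -
  have "\<phi> ` S \<noteq> {} \<and> \<phi> ` S \<subseteq> carrier R - {\<zero>\<^bsub>R\<^esub>}"
    using assms(2,3) by auto
  then obtain n :: nat where n: "n > 0" "principalideal (Idl\<^bsub>R\<^esub> ((\<lambda>d. d [^]\<^bsub>R\<^esub> n) ` \<phi> ` S)) R"
    using conjunct2[OF assms(1)[unfolded API_domain_def], THEN spec[of _ "\<phi> ` S"]] by auto
  have "S \<subseteq> D" using assms by auto
  obtain i where "i \<in> carrier R" "Idl\<^bsub>R\<^esub> ((\<lambda>d. d [^]\<^bsub>R\<^esub> n) ` \<phi> ` S) = Idl\<^bsub>R\<^esub> {i}"
    using principalideal.generate[OF n(2)] by auto
  then show ?thesis using that[OF n(1)] \<open>S \<subseteq> D\<close>
    unfolding carrier_copy by (auto simp: pow_image Idl_singleton)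
qed

text \<open>The operations commute with \<open>\<phi>\<close>, and coefficients taken from the image
  of \<open>E\<close> are pulled back by \<open>\<psi>\<close>, so integral equations can be handled
  in the original ring.\<close>

lemma integral_over_iff:
  assumes "E \<subseteq> D" "f \<in> D"
  shows "integral_over R (\<phi> ` E) (\<phi> f) \<longleftrightarrow>
    (\<exists>n c. (\<forall>i<n. c i \<in> E) \<and> f ^ n + (\<Sum>i<n. c i * f ^ i) = 0)"
proof -
  have eq: "\<phi> f [^]\<^bsub>R\<^esub> n \<oplus>\<^bsub>R\<^esub> (\<Oplus>\<^bsub>R\<^esub>i\<in>{..<n}. \<phi> (c i) \<otimes>\<^bsub>R\<^esub> \<phi> f [^]\<^bsub>R\<^esub> i) = \<zero>\<^bsub>R\<^esub>
      \<longleftrightarrow> f ^ n + (\<Sum>i<n. c i * f ^ i) = 0" if "\<forall>i<n. c i \<in> E" for n :: nat and c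
  proof -
    have mem: "c i \<in> D" if "i \<in> {..<n}" for i using \<open>\<forall>i<n. c i \<in> E\<close> that assms(1) by auto
    have "(\<Oplus>\<^bsub>R\<^esub>i\<in>{..<n}. \<phi> (c i) \<otimes>\<^bsub>R\<^esub> \<phi> f [^]\<^bsub>R\<^esub> i) = (\<Oplus>\<^bsub>R\<^esub>i\<in>{..<n}. \<phi> (c i * f ^ i))"
      by (rule add.finprod_cong') (use mem assms(2) in auto)
    also have "\<dots> = \<phi> (\<Sum>i<n. c i * f ^ i)"
      using finsum_copy[of "{..<n}" "\<lambda>i. c i * f ^ i"] mem assms(2) by simp
    finally show ?thesis 
      using finsum_copy[of "{..<n}" "\<lambda>i. c i * f ^ i"] mem assms(2) by simp
  qed
  show ?thesis
  proof
    assume "integral_over R (\<phi> ` E) (\<phi> f)"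
    then obtain n :: nat and c where c: "\<forall>i<n. c i \<in> \<phi> ` E"
      "\<phi> f [^]\<^bsub>R\<^esub> n \<oplus>\<^bsub>R\<^esub> (\<Oplus>\<^bsub>R\<^esub>i\<in>{..<n}. c i \<otimes>\<^bsub>R\<^esub> \<phi> f [^]\<^bsub>R\<^esub> i) = \<zero>\<^bsub>R\<^esub>"
      unfolding integral_over_def by blast
    have psi: "\<psi> (c i) \<in> E \<and> \<phi> (\<psi> (c i)) = c i" if i: "i < n" for i
    proof -
      obtain e where "e \<in> E" "c i = \<phi> e" using c(1) i by blast
      moreover from this have "e \<in> D" using assms(1) by blast
      ultimately show ?thesis by simp
    qed
    have "(\<Oplus>\<^bsub>R\<^esub>i\<in>{..<n}. c i \<otimes>\<^bsub>R\<^esub> \<phi> f [^]\<^bsub>R\<^esub> i) = (\<Oplus>\<^bsub>R\<^esub>i\<in>{..<n}. \<phi> (\<psi> (c i)) \<otimes>\<^bsub>R\<^esub> \<phi> f [^]\<^bsub>R\<^esub> i)"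
      by (rule add.finprod_cong') (use psi assms in \<open>auto intro!: m_closed phi_carrier simp del: copy_simps\<close>)
    with c(2) eq[of n "\<lambda>i. \<psi> (c i)"] psi
    have "(\<forall>i<n. \<psi> (c i) \<in> E) \<and> f ^ n + (\<Sum>i<n. \<psi> (c i) * f ^ i) = 0" by auto
    then show "\<exists>n c. (\<forall>i<n. c i \<in> E) \<and> f ^ n + (\<Sum>i<n. c i * f ^ i) = 0"
      by (intro exI)
  next
    assume "\<exists>n c. (\<forall>i<n. c i \<in> E) \<and> f ^ n + (\<Sum>i<n. c i * f ^ i) = 0"
    then obtain n c where c: "\<forall>i<n. c i \<in> E" "f ^ n + (\<Sum>i<n. c i * f ^ i) = 0" by auto
    show "integral_over R (\<phi> ` E) (\<phi> f)"
      unfolding integral_over_def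
      by (intro exI[of _ n] exI[of _ "\<lambda>i. \<phi> (c i)"] conjI) 
        (use c eq[OF c(1)] in auto)
  qed
qed

end

section \<open>Power series with leading coefficient in a subfield\<close>

unbundle fps_syntax

section \<open>Coefficients and orders of Laurent series\<close>

lemma fls_nth_0_mult:
  fixes f g :: "'a::comm_semiring_1 fls"
  assumes "0 \<le> fls_subdegree f" "0 \<le> fls_subdegree g"
  shows "(f * g) $$ 0 = f $$ 0 * g $$ 0"
proof -
  have "f * g = fps_to_fls (fls_regpart f) * fps_to_fls (fls_regpart g)"
    using assms by simp
  also have "\<dots> $$ 0 = fps_nth (fls_regpart f * fls_regpart g) 0"
    unfolding fls_times_fps_to_fls[symmetric] by simp
  finally show ?thesis by simp
qed

text \<open>The coefficient is \<open>f $$ 0 * g $$ 1 + f $$ 1 * g $$ 0\<close>, and the second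
  product vanishes. Thus the coefficient of x is linear on x L[[x]], with \<open>D\<close> acting
  through constant terms.\<close>

lemma fls_nth_1_mult:
  fixes f g :: "'a::comm_semiring_1 fls"
  assumes "0 \<le> fls_subdegree f" "0 \<le> fls_subdegree g" "g $$ 0 = 0"
  shows "(f * g) $$ 1 = f $$ 0 * g $$ 1"
proof -
  have "f * g = fps_to_fls (fls_regpart f) * fps_to_fls (fls_regpart g)"
    using assms by simp
  also have "\<dots> $$ 1 = fps_nth (fls_regpart f * fls_regpart g) 1"
    unfolding fls_times_fps_to_fls[symmetric] by simp
  finally show ?thesis using assms by (simp add: fps_mult_nth_1)
qed

lemma fls_nth_0_power:
  fixes f :: "'a::idom fls"
  assumes "0 \<le> fls_subdegree f"
  shows "(f ^ n) $$ 0 = (f $$ 0) ^ n"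
  by (induction n) (use assms in \<open>simp_all add: fls_nth_0_mult fls_subdegree_pow\<close>)

lemma fls_subdegree_nonneg_add:
  "0 \<le> fls_subdegree f \<Longrightarrow> 0 \<le> fls_subdegree g \<Longrightarrow> 0 \<le> fls_subdegree (f + g)"
  by (intro fls_subdegree_ge0I) auto

lemma fls_subdegree_nonneg_divide:
  fixes f g :: "'a::field fls"
  assumes "f \<noteq> 0" "fls_subdegree f \<le> fls_subdegree g"
  shows "0 \<le> fls_subdegree (g / f)"
  using assms by (cases "g = 0") (auto simp: fls_divide_subdegree)

lemma fls_subdegree_pos_iff:
  assumes "0 \<le> fls_subdegree f" "f \<noteq> 0"
  shows "0 < fls_subdegree f \<longleftrightarrow> f $$ 0 = 0"
  using assms nth_fls_subdegree_nonzero[of f] fls_eq0_below_subdegree[of 0 f]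
  by (cases "fls_subdegree f = 0") auto

text \<open>The ring k + x L[[x]] inside L((x)). The convention \<open>fls_subdegree 0 = 0\<close>
  lets zero pass the condition on the order.\<close>

definition series_over :: "'l::field set \<Rightarrow> 'l fls set" where
  "series_over k = {f. 0 \<le> fls_subdegree f \<and> f $$ 0 \<in> k}"

text \<open>The decoding law is asked for on all Laurent series, so that the same pair of codes
  serves k + x L[[x]], L[[x]] and L((x)).\<close>

locale residue_subfield =
  fixes k :: "'l::field set" and \<phi> :: "'l fls \<Rightarrow> 'c" and \<psi> :: "'c \<Rightarrow> 'l fls"
  assumes psi_phi: "\<psi> (\<phi> f) = f"
    and k_zero: "0 \<in> k" and k_one: "1 \<in> k"
    and k_add: "a \<in> k \<Longrightarrow> b \<in> k \<Longrightarrow> a + b \<in> k"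
    and k_mult: "a \<in> k \<Longrightarrow> b \<in> k \<Longrightarrow> a * b \<in> k"
    and k_uminus: "a \<in> k \<Longrightarrow> - a \<in> k"
    and k_inverse: "a \<in> k \<Longrightarrow> inverse a \<in> k"
begin

abbreviation "D \<equiv> series_over k"

sublocale transported_subring \<phi> \<psi> D
  by unfold_locales
    (simp_all add: series_over_def psi_phi k_zero k_one k_add k_mult k_uminus 
      fls_nth_0_mult fls_mult_subdegree_ge_0 fls_subdegree_nonneg_add)

lemma maximal_mem: "0 \<le> fls_subdegree f \<Longrightarrow> f $$ 0 = 0 \<Longrightarrow> f \<in> D"
  by (simp add: series_over_def k_zero)

lemma D_subdegree: "f \<in> D \<Longrightarrow> 0 \<le> fls_subdegree f"
  by (simp add: series_over_def)

lemma D_nth_0: "f \<in> D \<Longrightarrow> f $$ 0 \<in> k"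
  by (simp add: series_over_def)

text \<open>Order 0 passes to the inverse, whose constant term is the inverse of an element of the
  field \<open>k\<close>.\<close>

lemma inverse_mem:
  assumes "f \<in> D" "f $$ 0 \<noteq> 0"
  shows "inverse f \<in> D"
proof -
  have "f \<noteq> 0" using assms by auto
  then have "fls_subdegree f = 0"
    using fls_subdegree_pos_iff[of f] D_subdegree[OF assms(1)] assms(2) by auto
  then have "(f * inverse f) $$ 0 = f $$ 0 * inverse f $$ 0"
    by (intro fls_nth_0_mult) simp_all
  then have "f $$ 0 * inverse f $$ 0 = 1" using \<open>f \<noteq> 0\<close> by simp
  then have "inverse f $$ 0 = inverse (f $$ 0)" by (metis inverse_unique)
  with \<open>fls_subdegree f = 0\<close> show ?thesis
    using k_inverse[OF D_nth_0[OF assms(1)]] by (simp add: series_over_def)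
qed

lemma nonunit_iff: "f \<in> D \<Longrightarrow> (\<forall>d\<in>D. f * d \<noteq> 1) \<longleftrightarrow> f $$ 0 = 0"
proof
  assume f: "f \<in> D" and *: "\<forall>d\<in>D. f * d \<noteq> 1"
  show "f $$ 0 = 0"
  proof (rule ccontr)
    assume n: "f $$ 0 \<noteq> 0"
    then have "f \<noteq> 0" by auto
    then show False using * inverse_mem[OF f n] by auto
  qed
next
  assume f: "f \<in> D" and n: "f $$ 0 = 0"
  show "\<forall>d\<in>D. f * d \<noteq> 1"
  proof
    fix d assume "d \<in> D"
    then have "(f * d) $$ 0 = 0" using f n by (simp add: fls_nth_0_mult D_subdegree)
    then show "f * d \<noteq> 1" by auto
  qed
qed

section \<open>The maximal ideal x L[[x]]\<close>

definition "M = {f :: 'l fls. 0 \<le> fls_subdegree f \<and> f $$ 0 = 0}"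

lemma M_subset: "M \<subseteq> D"
  by (auto simp: M_def maximal_mem)

lemma M_eq: "M = {a\<in>D. \<forall>d\<in>D. a * d \<noteq> 1}"
  unfolding M_def by (rule Collect_cong) (use nonunit_iff maximal_mem D_subdegree in blast)

lemma quasilocal_R: "quasilocal R"
  by (rule quasilocalI) (simp add: nonunit_iff)

lemma qmax_R: "qmax R = \<phi> ` M"
  unfolding M_eq by (rule qmax_eq) (simp add: nonunit_iff)

section \<open>Almost divisibility and leading coefficients\<close>

lemma divide_mem_cases:
  assumes "f \<noteq> 0" "fls_subdegree f \<le> fls_subdegree g" "((g / f) $$ 0) ^ n \<in> k"
  shows "\<exists>c\<in>D. g ^ n = f ^ n * c"
proof
  show "(g / f) ^ n \<in> D"
    using fls_subdegree_nonneg_divide[OF assms(1,2)] assms(3)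
    by (simp add: series_over_def fls_subdegree_pow fls_nth_0_power)
  show "g ^ n = f ^ n * (g / f) ^ n"
    using assms(1) by (simp add: power_divide)
qed

text \<open>The element of smaller order is the candidate divisor. If the orders differ, the
  quotient has constant term 0 and lies in \<open>D\<close>, so \<open>n = 1\<close> works; if they
  agree, some power of the leading quotient lies in \<open>k\<close>.\<close>

lemma AV_domain_R:
  assumes "\<And>u. u \<noteq> 0 \<Longrightarrow> \<exists>n>0. u ^ n \<in> k"
  shows "AV_domain R"
proof (rule AV_domainI)
  have *: "\<exists>n>0. \<exists>c\<in>D. g ^ n = f ^ n * c" if "f \<noteq> 0" "fls_subdegree f \<le> fls_subdegree g" for f g
  proof (cases "(g / f) $$ 0 = 0")
    case True
    then have "\<exists>c\<in>D. g ^ 1 = f ^ 1 * c"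
      by (intro divide_mem_cases[OF that]) (simp only: k_zero power_one_right)
    then show ?thesis using zero_less_one by blast
  next
    case False
    then show ?thesis using assms divide_mem_cases[OF that] by metis
  qed
  fix a b assume "a \<in> D" "b \<in> D" "a \<noteq> 0" "b \<noteq> 0"
  then show "\<exists>n>0. (\<exists>c\<in>D. b ^ n = a ^ n * c) \<or> (\<exists>c\<in>D. a ^ n = b ^ n * c)"
    using *[of a b] *[of b a] by (cases "fls_subdegree a \<le> fls_subdegree b") force+
qed

text \<open>Orders on \<open>D\<close> are nonnegative, so \<open>nat\<close> loses nothing. Since
  zero has subdegree 0, it is removed from \<open>S\<close> before the lemma is applied.\<close>

lemma ex_min_subdegree:
  assumes "S \<noteq> {}" "S \<subseteq> D"
  obtains s where "s \<in> S" "\<And>t. t \<in> S \<Longrightarrow> fls_subdegree s \<le> fls_subdegree t"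
proof -
  obtain a where "a \<in> S" using assms by auto
  then obtain s where s: "s \<in> S" "\<forall>t. t \<in> S \<longrightarrow> nat (fls_subdegree s) \<le> nat (fls_subdegree t)"
    using ex_has_least_nat[of "\<lambda>s. s \<in> S" a "\<lambda>s. nat (fls_subdegree s)"] by blast
  show ?thesis
  proof (rule that[OF s(1)])
    fix t assume "t \<in> S"
    then show "fls_subdegree s \<le> fls_subdegree t"
      using s(2) assms(2) D_subdegree[of t] by force
  qed
qed

text \<open>One exponent serves all quotients, so an element of least order divides every other one
  once \<open>n\<close>-th powers are taken.\<close>

lemma API_domain_R:
  assumes "n > 0" "\<And>u. u ^ n \<in> k"
  shows "API_domain R"
proof (rule API_domainI)
  fix S :: "'l fls set" assume S: "S \<noteq> {}" "S \<subseteq> D - {0}"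
  then have "S \<subseteq> D" by auto
  then obtain s where s: "s \<in> S" "\<And>t. t \<in> S \<Longrightarrow> fls_subdegree s \<le> fls_subdegree t"
    using ex_min_subdegree[of S] S(1) by metis
  moreover have "s \<noteq> 0" using s S by auto
  ultimately have "\<forall>t\<in>S. \<exists>c\<in>D. t ^ n = s ^ n * c"
    using divide_mem_cases assms(2) by metis
  then show "\<exists>n>0. \<exists>s\<in>S. \<forall>t\<in>S. \<exists>c\<in>D. t ^ n = s ^ n * c"
    using assms(1) s(1) by blast
qed

lemma abs_ideal_subdegree_ge: "abs_ideal {f \<in> D. f = 0 \<or> m \<le> fls_subdegree f}"
  unfolding abs_ideal_def
proof (intro conjI ballI)
  fix a b assume "a \<in> {f \<in> D. f = 0 \<or> m \<le> fls_subdegree f}" "b \<in> {f \<in> D. f = 0 \<or> m \<le> fls_subdegree f}"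
  then show "a + b \<in> {f \<in> D. f = 0 \<or> m \<le> fls_subdegree f}"
    using fls_plus_subdegree[of a b] by auto
next
  fix d a assume "d \<in> D" "a \<in> {f \<in> D. f = 0 \<or> m \<le> fls_subdegree f}"
  then show "d * a \<in> {f \<in> D. f = 0 \<or> m \<le> fls_subdegree f}"
    using D_subdegree[of d] by (cases "d = 0"; cases "a = 0") auto
qed auto

text \<open>The test set consists of all c x with c nonzero. A generator \<open>g\<close> of the
  ideal of their \<open>n\<close>-th powers has order \<open>n\<close>, and comparing x^n = g d1
  with u^n x^n = g d exhibits u^n as a quotient of two constant terms from \<open>k\<close>.\<close>

lemma API_imp_bounded_exponent:
  assumes "API_domain R"
  obtains n where "n > 0" "\<And>u. u \<noteq> 0 \<Longrightarrow> u ^ n \<in> k"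
proof -
  let ?f = "\<lambda>c. fls_X * fls_const c :: 'l fls"
  define S where "S = ?f ` (- {0})"
  have sd: "?f c \<noteq> 0 \<and> fls_subdegree (?f c) = 1" if "c \<noteq> 0" for c
    using that by simp
  have SD: "S \<subseteq> D - {0}"
    using sd by (auto simp: S_def intro!: maximal_mem)
  have "1 \<in> - {0 :: 'l}" by simp
  then have S_ne: "S \<noteq> {}" unfolding S_def by blast
  obtain n g where n: "n > 0" "g \<in> D"
    "Idl\<^bsub>R\<^esub> (\<phi> ` (\<lambda>s. s ^ n) ` S) = \<phi> ` {g * d | d. d \<in> D}"
    by (rule API_domainE[OF assms S_ne SD])
  have S_pow: "(\<lambda>s. s ^ n) ` S \<subseteq> D" using SD by auto
  have "\<phi> ` (\<lambda>s. s ^ n) ` S \<subseteq> \<phi> ` {g * d | d. d \<in> D}"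
    unfolding n(3)[symmetric] by (rule genideal_self) (use S_pow in auto)
  moreover have "{g * d | d. d \<in> D} \<subseteq> D" using n(2) by auto
  ultimately have "(\<lambda>s. s ^ n) ` S \<subseteq> {g * d | d. d \<in> D}"
    using phi_image_subset_iff[OF S_pow] by simp
  then have ex: "\<exists>d\<in>D. ?f c ^ n = g * d" if "c \<noteq> 0" for c
    using that by (auto simp: S_def)
  \<comment> \<open>The series of order at least \<open>n\<close> form an ideal, which bounds the
    order of \<open>g\<close> from below.\<close>
  have "(\<lambda>s. s ^ n) ` S \<subseteq> {f \<in> D. f = 0 \<or> int n \<le> fls_subdegree f}"
    using S_pow sd by (auto simp: S_def fls_subdegree_pow)
  then have "Idl\<^bsub>R\<^esub> (\<phi> ` (\<lambda>s. s ^ n) ` S) \<subseteq> \<phi> ` {f \<in> D. f = 0 \<or> int n \<le> fls_subdegree f}"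
    by (intro Idl_subset abs_ideal_subdegree_ge)
  moreover have "g * 1 \<in> {g * d | d. d \<in> D}" using one_mem by blast
  then have "\<phi> g \<in> Idl\<^bsub>R\<^esub> (\<phi> ` (\<lambda>s. s ^ n) ` S)" by (auto simp: n(3))
  ultimately have "\<phi> g \<in> \<phi> ` {f \<in> D. f = 0 \<or> int n \<le> fls_subdegree f}" by blast
  then have g: "g = 0 \<or> int n \<le> fls_subdegree g" using n(2) by auto
  obtain d1 where d1: "d1 \<in> D" "fls_X ^ n = g * d1" using ex[of 1] by auto
  then have nz: "g \<noteq> 0" "d1 \<noteq> 0" by auto
  then have "int n = fls_subdegree g + fls_subdegree d1"
    using arg_cong[OF d1(2), of fls_subdegree] by simp
  \<comment> \<open>The order of \<open>g\<close> is at least \<open>n\<close>, that of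
    \<open>d1\<close> at least 0, and they add up to \<open>n\<close>.\<close>
  then have "fls_subdegree d1 = 0" using g nz D_subdegree[OF d1(1)] by auto
  then have d10: "d1 $$ 0 \<noteq> 0" using nz(2) nth_fls_subdegree_nonzero[of d1] by simp
  have "u ^ n \<in> k" if u: "u \<noteq> 0" for u
  proof -
    obtain d where d: "d \<in> D" "?f u ^ n = g * d" using ex[OF u] by auto
    then have "g * d = g * (d1 * fls_const u ^ n)"
      using d1(2) by (auto simp: power_mult_distrib)
    then have "d = d1 * fls_const u ^ n" using nz by simp
    then have "d $$ 0 = d1 $$ 0 * u ^ n"
      using D_subdegree[OF d1(1)] by (simp add: fls_nth_0_mult fls_nth_0_power fls_subdegree_pow)
    then have "u ^ n = d $$ 0 * inverse (d1 $$ 0)" using d10 by simp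
    then show ?thesis using k_mult k_inverse D_nth_0 d(1) d1(1) by simp
  qed
  then show ?thesis using that n(1) by blast
qed

section \<open>Finite and infinite generation of ideals\<close>

lemma principal_if_quotients:
  assumes "abs_ideal B" "f \<in> B" "f \<noteq> 0" "\<And>g. g \<in> B \<Longrightarrow> g / f \<in> D"
  shows "B = {f * d | d. d \<in> D}"
proof (intro equalityI subsetI)
  fix g assume "g \<in> B"
  moreover have "g = f * (g / f)" using assms(3) by simp
  ultimately show "g \<in> {f * d | d. d \<in> D}" using assms(4) by blast
next
  fix x assume "x \<in> {f * d | d. d \<in> D}"
  then show "x \<in> B" using assms(1,2) by (auto simp: abs_ideal_def mult.commute[of f])
qed

text \<open>By hypothesis 1 and any \<open>c \<notin> k\<close> span L over \<open>k\<close>. A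
  nonzero ideal is generated by an element \<open>f\<close> of least order, together with one
  \<open>g\<close> for which \<open>g / f\<close> has constant term outside \<open>k\<close>, if
  there is one.\<close>

lemma noetherian_R:
  assumes "\<And>c d. c \<notin> k \<Longrightarrow> \<exists>a\<in>k. \<exists>b\<in>k. d = a + b * c"
  shows "noetherian_ring R"
proof (unfold_locales)
  fix I assume "ideal I R"
  then obtain B where B: "abs_ideal B" "B \<subseteq> D" "I = \<phi> ` B" by (rule idealE)
  show "\<exists>A\<subseteq>carrier R. finite A \<and> I = Idl\<^bsub>R\<^esub> A"
  proof (cases "B = {0}")
    case True
    moreover have "{0 * d | d. d \<in> D} = {0}" by (auto intro!: exI[of _ 0])
    ultimately have "I = Idl\<^bsub>R\<^esub> {\<phi> 0}" using Idl_singleton[OF zero_mem] B(3) by simp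
    then show ?thesis by (intro exI[of _ "{\<phi> 0}"]) auto
  next
    case False
    then have "B - {0} \<noteq> {}" "B - {0} \<subseteq> D" using B by (auto simp: abs_ideal_def)
    then obtain f where f: "f \<in> B - {0}" "\<And>g. g \<in> B - {0} \<Longrightarrow> fls_subdegree f \<le> fls_subdegree g"
      using ex_min_subdegree by metis
    then have fD: "f \<in> D" "f \<noteq> 0" using B by auto
    have quot: "0 \<le> fls_subdegree (g / f)" if "g \<in> B" for g
      using fls_subdegree_nonneg_divide[OF fD(2) f(2)] that by (cases "g = 0") auto
    show ?thesis
    proof (cases "\<forall>g\<in>B. g / f \<in> D")
      case True
      then have "B = {f * d | d. d \<in> D}" using principal_if_quotients B f by auto
      then have "I = Idl\<^bsub>R\<^esub> {\<phi> f}" using Idl_singleton fD B by simp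
      then show ?thesis using fD by (intro exI[of _ "{\<phi> f}"]) auto
    next
      case False
      then obtain g where g: "g \<in> B" "g / f \<notin> D" by auto
      then have c: "(g / f) $$ 0 \<notin> k" using quot[OF g(1)] by (simp add: series_over_def)
      have "Idl\<^bsub>R\<^esub> (\<phi> ` {f, g}) = \<phi> ` B"
      proof (rule Idl_eqI[OF B(1)])
        show "{f, g} \<subseteq> B" using f g by auto
        fix C assume C: "abs_ideal C" "{f, g} \<subseteq> C"
        show "B \<subseteq> C"
        proof
          fix h assume h: "h \<in> B"
          obtain a b where ab: "a \<in> k" "b \<in> k" "(h / f) $$ 0 = a + b * (g / f) $$ 0"
            using assms[OF c] by metis
          have const: "fls_const a \<in> D" "fls_const b \<in> D"
            using ab by (auto simp: series_over_def)
          \<comment> \<open>Subtracting \<open>a * f + b * g\<close> from \<open>h\<close> removes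
            the constant term of \<open>h / f\<close>. What remains is \<open>f\<close> times an
            element of x L[[x]], a subset of \<open>D\<close>.\<close>
          define r where "r = h / f + fls_const (- a) + fls_const (- b) * (g / f)"
          have "r \<in> D"
          proof (rule maximal_mem)
            show "0 \<le> fls_subdegree r" unfolding r_def
              by (intro fls_subdegree_nonneg_add fls_mult_subdegree_ge_0 quot h g) auto
            show "r $$ 0 = 0" using ab(3) by (simp add: r_def del: times_divide_eq_right)
          qed
          have "h = r * f + fls_const a * f + fls_const b * g"
            using fD(2) unfolding r_def by (simp add: field_simps)
          moreover have "r * f \<in> C" "fls_const a * f \<in> C" "fls_const b * g \<in> C"
            using C \<open>r \<in> D\<close> const unfolding abs_ideal_def by auto
          ultimately show "h \<in> C" using C(1) unfolding abs_ideal_def by auto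
        qed
      qed
      then have "I = Idl\<^bsub>R\<^esub> (\<phi> ` {f, g})" using B by simp
      then show ?thesis using fD g B by (intro exI[of _ "\<phi> ` {f, g}"]) auto
    qed
  qed
qed

text \<open>The hypothesis says that L has infinite dimension over \<open>k\<close>. The elements of
  \<open>M\<close> whose coefficient of x lies in a proper subspace \<open>W\<close> form an ideal
  smaller than \<open>M\<close>; a suitable \<open>W\<close> puts any given finite subset of
  \<open>M\<close> into such an ideal, so \<open>M\<close> is not finitely generated.\<close>

lemma not_noetherian_R:
  assumes "\<And>F. finite F \<Longrightarrow> \<exists>W. F \<subseteq> W \<and> W \<noteq> UNIV \<and> 0 \<in> W \<and> 
      (\<forall>a\<in>W. \<forall>b\<in>W. a + b \<in> W) \<and> (\<forall>c\<in>k. \<forall>a\<in>W. c * a \<in> W)"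
  shows "\<not> noetherian_ring R"
proof
  assume "noetherian_ring R"
  then interpret N: noetherian_ring R .
  have idM: "abs_ideal M" unfolding abs_ideal_def
    using M_subset by (auto simp: M_def fls_nth_0_mult D_subdegree fls_mult_subdegree_ge_0
       fls_subdegree_nonneg_add)
  then have "ideal (\<phi> ` M) R" using M_subset by (simp add: abs_ideal_iff)
  then obtain A where A: "A \<subseteq> carrier R" "finite A" "\<phi> ` M = Idl\<^bsub>R\<^esub> A"
    using N.finetely_gen by metis
  have "A \<subseteq> \<phi> ` M" using A genideal_self by simp
  then obtain F where F: "F \<subseteq> M" "finite F" "A = \<phi> ` F"
    using finite_subset_image[OF A(2), of \<phi> M] by blast
  obtain W where W': "(\<lambda>f. f $$ 1) ` F \<subseteq> W \<and> W \<noteq> UNIV \<and> 0 \<in> W \<and>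
      (\<forall>a\<in>W. \<forall>b\<in>W. a + b \<in> W) \<and> (\<forall>c\<in>k. \<forall>a\<in>W. c * a \<in> W)"
    using assms[OF finite_imageI[OF F(2)]] ..
  then have W: "(\<lambda>f. f $$ 1) ` F \<subseteq> W" "W \<noteq> UNIV" "0 \<in> W"
      "a \<in> W \<Longrightarrow> b \<in> W \<Longrightarrow> a + b \<in> W" "c \<in> k \<Longrightarrow> a \<in> W \<Longrightarrow> c * a \<in> W" for a b c
    by blast+
  define B where "B = {f \<in> M. f $$ 1 \<in> W}"
  have "abs_ideal B" unfolding abs_ideal_def
  proof (intro conjI ballI)
    fix d a assume "d \<in> D" "a \<in> B"
    then show "d * a \<in> B"
      using idM W(5)[OF D_nth_0] D_subdegree[of d]
      by (auto simp: B_def fls_nth_1_mult M_def abs_ideal_def)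
  qed (use M_subset idM W in \<open>auto simp: B_def abs_ideal_def\<close>)
  moreover have "F \<subseteq> B" using F W by (auto simp: B_def)
  ultimately have "\<phi> ` M \<subseteq> \<phi> ` B" unfolding A(3) F(3) by (rule Idl_subset)
  moreover obtain t where "t \<notin> W" using W(2) by auto
  moreover have "fls_X * fls_const t \<in> M"
    by (cases "t = 0") (auto simp: M_def)
  ultimately have "\<phi> (fls_X * fls_const t) \<in> \<phi> ` B" by auto
  then have "fls_X * fls_const t \<in> B"
    using \<open>fls_X * fls_const t \<in> M\<close> M_subset by (subst (asm) phi_mem_iff) (auto simp: B_def)
  then show False using \<open>t \<notin> W\<close> by (simp add: B_def fls_X_times_conv_shift)
qed

section \<open>Powers of the maximal ideal\<close>

lemma ideal_pow_subset:
  "ideal_pow R (\<phi> ` M) n \<subseteq> \<phi> ` {f \<in> D. f = 0 \<or> int n \<le> fls_subdegree f}"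
proof (induction n)
  case 0
  then show ?case by (auto simp: carrier_copy D_subdegree)
next
  case (Suc n)
  let ?B = "{f \<in> D. f = 0 \<or> int (Suc n) \<le> fls_subdegree f}"
  have I: "abs_ideal ?B" by (rule abs_ideal_subdegree_ge)
  show ?case
  proof
    fix x assume "x \<in> ideal_pow R (\<phi> ` M) (Suc n)"
    then have "x \<in> ideal_prod R (\<phi> ` M) (ideal_pow R (\<phi> ` M) n)" by simp
    then show "x \<in> \<phi> ` ?B"
    proof induction
      case (prod i j)
      then obtain a b where ab: "i = \<phi> a" "a \<in> M" "j = \<phi> b" "b \<in> D" "b = 0 \<or> int n \<le> fls_subdegree b"
        using Suc by auto
      have "a * b = 0 \<or> int (Suc n) \<le> fls_subdegree (a * b)"
        using ab fls_subdegree_pos_iff[of a] by (cases "a = 0"; cases "b = 0") (auto simp: M_def)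
      moreover have "a \<in> D" using ab M_subset by auto
      ultimately show ?case using ab by auto
    next
      case (sum s1 s2)
      then obtain a b where ab: "s1 = \<phi> a" "s2 = \<phi> b" "a \<in> ?B" "b \<in> ?B" by blast
      then have "a + b \<in> ?B" using I unfolding abs_ideal_def by blast
      moreover have "s1 \<oplus>\<^bsub>R\<^esub> s2 = \<phi> (a + b)" using ab by auto
      ultimately show ?case by blast
    qed
  qed
qed

lemma cond3_R:
  assumes "AV_domain R"
  shows "cond3 R"
  unfolding cond3_def
proof (intro conjI assms allI impI)
  fix A assume A: "ideal A R \<and> A \<noteq> {\<zero>\<^bsub>R\<^esub>} \<and> A \<noteq> carrier R"
  then obtain B where B: "abs_ideal B" "B \<subseteq> D" "A = \<phi> ` B" using idealE by metis
  then obtain f where f: "f \<in> B" "f \<noteq> 0" using A by (auto simp: abs_ideal_def)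
  \<comment> \<open>One more than the order of \<open>f\<close>: a nonzero \<open>g\<close> of order
    at least \<open>n\<close> then has a quotient \<open>g / f\<close> of positive order, which lies
    in \<open>D\<close> whatever \<open>k\<close> is.\<close>
  define n where "n = nat (fls_subdegree f + 1)"
  have "{g \<in> D. g = 0 \<or> int n \<le> fls_subdegree g} \<subseteq> B"
  proof
    fix g assume g: "g \<in> {g \<in> D. g = 0 \<or> int n \<le> fls_subdegree g}"
    have "fls_subdegree f \<ge> 0" using f B D_subdegree by auto
    then have "g / f \<in> D" using g f
      by (cases "g = 0") (auto intro!: maximal_mem simp: n_def fls_divide_subdegree)
    then have "(g / f) * f \<in> B" using B(1) f unfolding abs_ideal_def by blast
    then show "g \<in> B" using f by simp
  qed
  then show "\<exists>n. ideal_pow R (qmax R) n \<subseteq> A"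
    unfolding qmax_R B(3) using ideal_pow_subset[of n] by blast
qed

section \<open>Quotient field and integral closure\<close>

interpretation K: transported_subring \<phi> \<psi> UNIV
  by unfold_locales (simp_all add: psi_phi)

text \<open>With all of L as residue field the ring becomes L[[x]], the prospective integral
  closure.\<close>

interpretation V: residue_subfield UNIV \<phi> \<psi>
  by unfold_locales (simp_all add: psi_phi)

lemma field_K: "field K.R"
proof (rule K.cring_fieldI)
  show "Units K.R = carrier K.R - {\<zero>\<^bsub>K.R\<^esub>}"
  proof (intro equalityI subsetI)
    fix x assume "x \<in> carrier K.R - {\<zero>\<^bsub>K.R\<^esub>}"
    then obtain f where f: "x = \<phi> f" "f \<noteq> 0" by (auto simp: K.carrier_copy)
    then have "f * inverse f = 1" by simp
    then show "x \<in> Units K.R" using f(1) unfolding K.Units_copy by blast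
  qed (auto simp: K.Units_copy K.carrier_copy)
qed

lemma inv_K: "f \<noteq> 0 \<Longrightarrow> inv\<^bsub>K.R\<^esub> (\<phi> f) = \<phi> (inverse f)"
  by (rule K.comm_inv_char) (auto simp: K.carrier_copy)

lemma quotient_field: "quotient_field_of R K.R id"
  unfolding quotient_field_of_def
proof (intro conjI ballI domain_copy field_K)
  show "id \<in> ring_hom R K.R"
    by (rule ring_hom_memI) (auto simp: carrier_copy)
  fix x assume "x \<in> carrier K.R"
  then obtain f where f: "x = \<phi> f" by (auto simp: K.carrier_copy)
  \<comment> \<open>Chosen so that both the power of x and its product with \<open>f\<close> vanish
    or have positive order, hence lie in \<open>D\<close>.\<close>
  define n where "n = nat (1 - fls_subdegree f) + 1"
  have "fls_X ^ n \<in> D" by (rule maximal_mem) (auto simp: n_def)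
  moreover have "f * fls_X ^ n \<in> D"
    by (cases "f = 0") (auto intro!: maximal_mem simp: n_def)
  moreover have "f = f * fls_X ^ n * inverse (fls_X ^ n)" by simp
  then have "x = \<phi> (f * fls_X ^ n) \<otimes>\<^bsub>K.R\<^esub> inv\<^bsub>K.R\<^esub> (\<phi> (fls_X ^ n))"
    using f by (subst inv_K) auto
  ultimately show "\<exists>a\<in>carrier R. \<exists>b\<in>carrier R. b \<noteq> \<zero>\<^bsub>R\<^esub> \<and> x = id a \<otimes>\<^bsub>K.R\<^esub> inv\<^bsub>K.R\<^esub> (id b)"
    by (intro bexI[of _ "\<phi> (f * fls_X ^ n)"] bexI[of _ "\<phi> (fls_X ^ n)"]) auto
qed auto

text \<open>If \<open>f\<close> had negative order, \<open>f ^ n\<close> would have strictly lower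
  order than every other term, and its leading coefficient could not cancel.\<close>

lemma integral_imp_subdegree_nonneg:
  assumes "\<forall>i<n. c i \<in> D" "f ^ n + (\<Sum>i<n. c i * f ^ i) = 0"
  shows "0 \<le> fls_subdegree f"
proof (rule ccontr)
  assume neg: "\<not> 0 \<le> fls_subdegree f"
  then have nz: "f \<noteq> 0" by auto
  define m where "m = int n * fls_subdegree f"
  have "(c i * f ^ i) $$ m = 0" if "i < n" for i
  proof (rule fls_times_nth_eq0)
    have "int n * fls_subdegree f < int i * fls_subdegree f"
      using that neg by (intro mult_strict_right_mono_neg) auto
    then show "m < fls_subdegree (c i) + fls_subdegree (f ^ i)"
      using D_subdegree[of "c i"] assms(1) that by (simp add: m_def fls_subdegree_pow)
  qed
  then have "(f ^ n + (\<Sum>i<n. c i * f ^ i)) $$ m = (f ^ n) $$ m"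
    by (simp add: fls_nth_sum)
  also have "\<dots> \<noteq> 0"
    using nth_fls_subdegree_nonzero[of "f ^ n"] nz by (simp add: m_def fls_subdegree_pow)
  finally show False using assms(2) by simp
qed

text \<open>An integral series has nonnegative order. Conversely, a series \<open>f\<close> in
  L[[x]] has some \<open>f ^ n\<close> in \<open>D\<close> and is a root of T^n - f^n.\<close>

lemma integral_closure_eq:
  assumes "\<And>u. u \<noteq> 0 \<Longrightarrow> \<exists>n>0. u ^ n \<in> k"
  shows "integral_closure_in K.R id R = V.R"
proof -
  have "integral_over K.R (\<phi> ` D) (\<phi> f) \<longleftrightarrow> f \<in> V.D" for f
  proof
    assume "integral_over K.R (\<phi> ` D) (\<phi> f)"
    then have "\<exists>n c. (\<forall>i<n. c i \<in> D) \<and> f ^ n + (\<Sum>i<n. c i * f ^ i) = 0"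
      by (subst (asm) K.integral_over_iff) simp_all
    then have "0 \<le> fls_subdegree f" using integral_imp_subdegree_nonneg by blast
    then show "f \<in> V.D" by (simp add: series_over_def)
  next
    assume "f \<in> V.D"
    then have f: "0 \<le> fls_subdegree f" by (simp add: series_over_def)
    \<comment> \<open>The hypothesis speaks of nonzero elements only; exponent 1 serves a vanishing
      constant term.\<close>
    have "0 ^ 1 \<in> k" using k_zero by simp
    then have "\<exists>n>0. (f $$ 0) ^ n \<in> k" using assms[of "f $$ 0"] zero_less_one by metis
    then obtain n where n: "n > 0" "(f $$ 0) ^ n \<in> k" by blast
    then have "f ^ n \<in> D" using f by (simp add: series_over_def fls_nth_0_power fls_subdegree_pow)
    define c where "c i = (if i = 0 then - (f ^ n) else 0)" for i :: nat
    have "(\<Sum>i<n. c i * f ^ i) = (\<Sum>i<n. if i = 0 then - (f ^ n) else 0)"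
      by (intro sum.cong) (auto simp: c_def)
    then have "(\<forall>i<n. c i \<in> D) \<and> f ^ n + (\<Sum>i<n. c i * f ^ i) = 0"
      using \<open>f ^ n \<in> D\<close> n(1) by (simp add: c_def)
    then show "integral_over K.R (\<phi> ` D) (\<phi> f)"
      by (subst K.integral_over_iff) (intro subset_UNIV UNIV_I exI)+
  qed
  then have "{x \<in> carrier K.R. integral_over K.R (\<phi> ` D) x} = \<phi> ` V.D"
    unfolding K.carrier_copy by blast
  \<comment> \<open>The operations of \<open>copy\<close> do not depend on the subset, so comparing
    carriers is enough.\<close>
  then show ?thesis
    unfolding integral_closure_in_def by (simp add: carrier_copy) (simp add: copy_def)
qed

text \<open>A nonzero ideal is generated by an element of least order, all quotients by it being
  power series. The ring is not a field because \<open>fls_X\<close> is a nonzero nonunit.\<close>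

lemma DVR_V: "DVR V.R"
proof -
  have pd: "principal_domain V.R"
  proof (unfold_locales)
    fix I assume "ideal I V.R"
    then obtain B where B: "V.abs_ideal B" "B \<subseteq> V.D" "I = \<phi> ` B" by (rule V.idealE)
    have "\<exists>a\<in>V.D. B = {a * d | d. d \<in> V.D}"
    proof (cases "B = {0}")
      case True
      have "{0 * d | d. d \<in> V.D} = {0}" by (auto intro!: exI[of _ 0])
      with True show ?thesis by (intro bexI[of _ 0]) auto
    next
      case False
      then have "B - {0} \<noteq> {}" "B - {0} \<subseteq> V.D" using B by (auto simp: V.abs_ideal_def)
      then obtain f where f: "f \<in> B - {0}" "\<And>g. g \<in> B - {0} \<Longrightarrow> fls_subdegree f \<le> fls_subdegree g"
        using V.ex_min_subdegree by metis
      have "B = {f * d | d. d \<in> V.D}"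
      proof (rule V.principal_if_quotients[OF B(1)])
        fix g assume "g \<in> B"
        then show "g / f \<in> V.D"
          using fls_subdegree_nonneg_divide[of f g] f by (cases "g = 0") (auto simp: series_over_def)
      qed (use f in auto)
      moreover have "f \<in> V.D" using f(1) B(2) by blast
      ultimately show ?thesis by blast
    qed
    then obtain a where a: "a \<in> V.D" "B = {a * d | d. d \<in> V.D}" by auto
    then have "I = Idl\<^bsub>V.R\<^esub> {\<phi> a}" using V.Idl_singleton B(3) by simp
    then have "I = PIdl\<^bsub>V.R\<^esub> (\<phi> a)" using V.cgenideal_eq_genideal[of "\<phi> a"] a(1) by simp
    then show "\<exists>a\<in>carrier V.R. I = PIdl\<^bsub>V.R\<^esub> a" using a(1) by auto
  qed
  interpret P: principal_domain V.R by (rule pd)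
  have "\<phi> fls_X \<notin> Units V.R"
  proof
    assume "\<phi> fls_X \<in> Units V.R"
    moreover have X: "fls_X \<in> V.D" by (simp add: series_over_def)
    ultimately have "\<not> (\<forall>d\<in>V.D. fls_X * d \<noteq> 1)" unfolding V.Units_copy by auto
    then show False using V.nonunit_iff[OF X] by simp
  qed
  moreover have "\<phi> fls_X \<in> carrier V.R - {\<zero>\<^bsub>V.R\<^esub>}"
    by (simp add: V.carrier_copy) (simp add: series_over_def)
  ultimately have "\<not> field V.R" by (auto dest: field.field_Units)
  then show ?thesis
    unfolding DVR_def is_local_def
    using P.noetherian_ring_axioms V.quasilocal_R pd by simp
qed

lemma cond4_R:
  assumes "\<And>u. u \<noteq> 0 \<Longrightarrow> \<exists>n>0. u ^ n \<in> k"
  shows "cond4 R"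
  unfolding cond4_def closure_is_DVR_def
  using AV_domain_R[OF assms] quotient_field DVR_V integral_closure_eq[OF assms] by metis

end

section \<open>The perfect closure of a power series ring\<close>

instance bit :: countable
  by (rule countable_classI[of "\<lambda>b. if b = 0 then 0 else 1"]) (auto split: if_splits)

text \<open>A function between countable types is stored as its graph, coded as a set of naturals;
  the outer singleton lifts this set to the type \<open>nat set set\<close>.\<close>

lemma inj_graph:
  "inj (\<lambda>F :: 'i::countable \<Rightarrow> 'b::countable. {range (\<lambda>i. to_nat (i, F i))})"
proof (rule injI)
  fix F G :: "'i \<Rightarrow> 'b"
  assume "{range (\<lambda>i. to_nat (i, F i))} = {range (\<lambda>i. to_nat (i, G i))}"
  then have *: "to_nat (i, F i) \<in> range (\<lambda>i. to_nat (i, G i))" for i by blast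
  have "F i = G i" for i using *[of i] by auto
  then show "F = G" by (rule ext)
qed

lemma add_power_two_power:
  fixes x y :: "'a::comm_ring_1"
  assumes "(2::'a) = 0"
  shows "(x + y) ^ (2 ^ n) = x ^ (2 ^ n) + y ^ (2 ^ n)"
proof (induction n)
  case (Suc n)
  then show ?case using assms by (simp add: power_mult power2_sum power_mult[of _ "2 ^ n" 2] mult.commute[of 2])
qed simp

lemma uminus_eq_self:
  fixes x :: "'a::comm_ring_1"
  assumes "(2::'a) = 0"
  shows "- x = x"
proof -
  have "x + x = 2 * x" by simp
  also have "\<dots> = 0" using assms by simp
  finally show ?thesis by (rule minus_unique)
qed

text \<open>The Frobenius map is additive, and a domain has no nonzero nilpotent elements.\<close>

lemma two_power_eq_imp_eq:
  fixes x y :: "'a::idom"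
  assumes "(2::'a) = 0" "x ^ (2 ^ n) = y ^ (2 ^ n)"
  shows "x = y"
proof -
  have "(x + y) ^ (2 ^ n) = y ^ (2 ^ n) + y ^ (2 ^ n)"
    using assms by (simp add: add_power_two_power)
  also have "\<dots> = 0" using uminus_eq_self[OF assms(1)] by (metis add.right_inverse)
  finally have "x + y = 0" by simp
  then show ?thesis using uminus_eq_self[OF assms(1), of y] by (metis add.commute minus_unique)
qed

lemma two_eq_0_bit_fls_ac: "(2 :: bit fls alg_closure) = 0"
proof -
  have "(2 :: bit fls) = fls_const (2 :: bit)" by (rule fls_const_numeral[symmetric])
  also have "\<dots> = fls_const 0" by (simp only: bit_2_eq_0)
  finally have "(2 :: bit fls) = 0" by simp
  then show ?thesis by (metis to_ac_0 to_ac_numeral)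
qed

text \<open>Embeds F_2[[x]] in an algebraic closure of F_2((x)), where all roots are
  available.\<close>

definition fps_ac :: "bit fps \<Rightarrow> bit fls alg_closure" where
  "fps_ac f = to_ac (fps_to_fls f)"

lemma fps_ac_simps [simp]:
  "fps_ac 0 = 0" "fps_ac 1 = 1" "fps_ac (f + g) = fps_ac f + fps_ac g"
  "fps_ac (f * g) = fps_ac f * fps_ac g" "fps_ac (f ^ n) = fps_ac f ^ n"
  "fps_ac f = fps_ac g \<longleftrightarrow> f = g"
  by (simp_all add: fps_ac_def fls_times_fps_to_fls fps_to_fls_power)

lemma fps_ac_eq_iffs [simp]: "fps_ac f = 0 \<longleftrightarrow> f = 0" "fps_ac f = 1 \<longleftrightarrow> f = 1"
  by (simp_all add: fps_ac_def)

text \<open>All 2-power roots of power series, that is, the union of the rings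
  F_2[[x^(1/2^n)]].\<close>

definition perfect_closure :: "bit fls alg_closure set" where
  "perfect_closure = {y. \<exists>n f. y ^ (2 ^ n) = fps_ac f}"

text \<open>Brings two elements to a common exponent before they are added or multiplied.\<close>

lemma two_power_lift: "y ^ (2 ^ n) = fps_ac f \<Longrightarrow> y ^ (2 ^ (n + m)) = fps_ac (f ^ (2 ^ m))"
  by (simp add: power_add power_mult)

lemma perfect_closure_add:
  assumes "x ^ (2 ^ n) = fps_ac f" "y ^ (2 ^ m) = fps_ac g"
  shows "(x + y) ^ (2 ^ (n + m)) = fps_ac (f ^ (2 ^ m) + g ^ (2 ^ n))"
  using two_power_lift[OF assms(1), of m] two_power_lift[OF assms(2), of n]
  by (simp add: add_power_two_power[OF two_eq_0_bit_fls_ac] add.commute[of m])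

lemma perfect_closure_mult:
  assumes "x ^ (2 ^ n) = fps_ac f" "y ^ (2 ^ m) = fps_ac g"
  shows "(x * y) ^ (2 ^ (n + m)) = fps_ac (f ^ (2 ^ m) * g ^ (2 ^ n))"
  using two_power_lift[OF assms(1), of m] two_power_lift[OF assms(2), of n]
  by (simp add: power_mult_distrib add.commute[of m])

lemma fps_ac_mem: "fps_ac f \<in> perfect_closure"
  unfolding perfect_closure_def by (auto intro!: exI[of _ "0::nat"])

text \<open>By injectivity of the Frobenius map, the pair of \<open>n\<close> and \<open>f\<close>
  determines the root \<open>y\<close>. Some such pair is chosen and stored as the graph of the map
  sending \<open>i\<close> to \<open>n\<close> and the \<open>i\<close>-th coefficient of
  \<open>f\<close>.\<close>

definition perfect_closure_code :: "bit fls alg_closure \<Rightarrow> nat set set" where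
  "perfect_closure_code y =
     (let (n, f) = SOME (n, f). y ^ (2 ^ n) = fps_ac f
      in {range (\<lambda>i. to_nat (i, n :: nat, fps_nth f i))})"

lemma inj_on_perfect_closure_code: "inj_on perfect_closure_code perfect_closure"
proof (rule inj_onI)
  fix x y assume xy: "x \<in> perfect_closure" "y \<in> perfect_closure"
    "perfect_closure_code x = perfect_closure_code y"
  define P where "P y = (SOME (n, f). y ^ (2 ^ n) = fps_ac f)" for y
  have P: "y ^ (2 ^ fst (P y)) = fps_ac (snd (P y))" if "y \<in> perfect_closure" for y
  proof -
    have "\<exists>p. (\<lambda>(n, f). y ^ (2 ^ n) = fps_ac f) p" using that by (auto simp: perfect_closure_def)
    then have "(\<lambda>(n, f). y ^ (2 ^ n) = fps_ac f) (P y)" unfolding P_def by (rule someI_ex)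
    then show ?thesis by (simp add: case_prod_beta)
  qed
  have "{range (\<lambda>i. to_nat (i, fst (P x), fps_nth (snd (P x)) i))} =
      {range (\<lambda>i. to_nat (i, fst (P y), fps_nth (snd (P y)) i))}"
    using xy(3) by (simp add: perfect_closure_code_def P_def[symmetric] case_prod_beta)
  from injD[OF inj_graph, of "\<lambda>i. (fst (P x), fps_nth (snd (P x)) i)" "\<lambda>i. (fst (P y), fps_nth (snd (P y)) i)", OF this]
  have "P x = P y"
    by (auto simp: fun_eq_iff fps_eq_iff prod_eq_iff)
  then have "x ^ (2 ^ fst (P x)) = y ^ (2 ^ fst (P x))" using P xy by metis
  then show "x = y" by (rule two_power_eq_imp_eq[OF two_eq_0_bit_fls_ac])
qed

interpretation pc: transported_subring perfect_closure_code "the_inv_into perfect_closure perfect_closure_code" perfect_closure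
proof unfold_locales
  fix a b assume ab: "a \<in> perfect_closure" "b \<in> perfect_closure"
  show "a + b \<in> perfect_closure" "a * b \<in> perfect_closure"
    using ab perfect_closure_add perfect_closure_mult unfolding perfect_closure_def by blast+
next
  show "0 \<in> perfect_closure" "1 \<in> perfect_closure"
    using fps_ac_mem[of 0] fps_ac_mem[of 1] by simp_all
qed (simp_all add: the_inv_into_f_f[OF inj_on_perfect_closure_code] uminus_eq_self[OF two_eq_0_bit_fls_ac])

text \<open>Being a unit passes from \<open>y\<close> to its power \<open>f\<close> and back, since
  the inverse of \<open>y\<close> is a root of \<open>inverse f\<close>.\<close>

lemma perfect_closure_unit_iff:
  assumes "y ^ (2 ^ n) = fps_ac f"
  shows "(\<exists>d\<in>perfect_closure. y * d = 1) \<longleftrightarrow> fps_nth f 0 \<noteq> 0"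
proof
  assume "\<exists>d\<in>perfect_closure. y * d = 1"
  then obtain d m g where d: "y * d = 1" "d ^ (2 ^ m) = fps_ac g" by (auto simp: perfect_closure_def)
  have "fps_ac (f ^ (2 ^ m) * g ^ (2 ^ n)) = fps_ac 1"
    using perfect_closure_mult[OF assms d(2)] d(1) by simp
  then have "f ^ (2 ^ m) * g ^ (2 ^ n) = 1" using fps_ac_simps(6) by blast
  then have "fps_nth f 0 ^ (2 ^ m) * fps_nth g 0 ^ (2 ^ n) = 1"
    by (metis fps_mult_nth_0 fps_nth_power_0 fps_one_nth)
  then show "fps_nth f 0 \<noteq> 0" by (auto simp del: power_bit_unfold simp: power_0_left)
next
  assume "fps_nth f 0 \<noteq> 0"
  then have "inverse f * f = 1" by (rule inverse_mult_eq_1)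
  then have inv: "fps_ac (inverse f) * fps_ac f = 1" by (metis fps_ac_simps(2,4))
  have "y \<noteq> 0" using assms \<open>fps_nth f 0 \<noteq> 0\<close> by (auto simp: power_0_left)
  have "inverse y ^ (2 ^ n) = inverse (fps_ac f)" using assms by (simp add: power_inverse)
  also have "\<dots> = fps_ac (inverse f)" using inv by (metis inverse_unique mult.commute)
  finally have "inverse y \<in> perfect_closure" unfolding perfect_closure_def by blast
  then show "\<exists>d\<in>perfect_closure. y * d = 1" using \<open>y \<noteq> 0\<close> by (intro bexI[of _ "inverse y"]) auto
qed

section \<open>The maximal ideal of the perfect closure\<close>

definition pc_nonunits :: "bit fls alg_closure set" where
  "pc_nonunits = {a \<in> perfect_closure. \<forall>d\<in>perfect_closure. a * d \<noteq> 1}"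

lemma pc_nonunits_iff:
  assumes "y ^ (2 ^ n) = fps_ac f"
  shows "y \<in> pc_nonunits \<longleftrightarrow> fps_nth f 0 = 0"
proof -
  have "y \<in> perfect_closure" using assms unfolding perfect_closure_def by blast
  then show ?thesis using perfect_closure_unit_iff[OF assms] by (auto simp: pc_nonunits_def)
qed

lemma pc_nonunits_add:
  assumes "x \<in> pc_nonunits" "y \<in> pc_nonunits"
  shows "x + y \<in> pc_nonunits"
proof -
  obtain n f m g where fg: "x ^ (2 ^ n) = fps_ac f" "y ^ (2 ^ m) = fps_ac g"
    using assms by (auto simp: pc_nonunits_def perfect_closure_def)
  then have "fps_nth f 0 = 0" "fps_nth g 0 = 0" using assms pc_nonunits_iff by blast+
  then show ?thesis 
    by (subst pc_nonunits_iff[OF perfect_closure_add[OF fg]]) (simp add: fps_nth_power_0 power_0_left)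
qed

lemma quasilocal_pc: "quasilocal pc.R"
  by (rule pc.quasilocalI) (use pc_nonunits_add in \<open>simp add: pc_nonunits_def\<close>)

lemma qmax_pc: "qmax pc.R = perfect_closure_code ` pc_nonunits"
  unfolding pc_nonunits_def by (rule pc.qmax_eq) (use pc_nonunits_add in \<open>simp add: pc_nonunits_def\<close>)

lemma pc_X_nonunit: "fps_ac fps_X \<in> pc_nonunits"
  using pc_nonunits_iff[of "fps_ac fps_X" 0 fps_X] by simp

text \<open>A nonzero nonunit has a power that is a power series, hence a unit times x^k; here
  \<open>k > 0\<close> because nonunits have powers with constant term 0.\<close>

lemma cond7_pc: "cond7 pc.R"
  unfolding cond7_def RAV_domain_def
proof (intro conjI)
  let ?X = "fps_ac fps_X"
  have Xmem: "?X \<in> perfect_closure" by (rule fps_ac_mem)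
  show "domain pc.R" by (rule pc.domain_copy)
  show "\<not> field pc.R"
  proof
    assume "field pc.R"
    then have "perfect_closure_code ?X \<in> Units pc.R"
      using Xmem by (subst field.field_Units) auto
    then have "\<exists>d\<in>perfect_closure. ?X * d = 1"
      using Xmem unfolding pc.Units_copy by (subst (asm) pc.phi_mem_iff) auto
    then show False using pc_X_nonunit by (auto simp: pc_nonunits_def)
  qed
  show "\<exists>a\<in>carrier pc.R. \<forall>y\<in>carrier pc.R - {\<zero>\<^bsub>pc.R\<^esub>} - Units pc.R.
        \<exists>(m::nat) (n::nat). \<exists>u\<in>Units pc.R. m > 0 \<and> n > 0 \<and> y [^]\<^bsub>pc.R\<^esub> m = u \<otimes>\<^bsub>pc.R\<^esub> a [^]\<^bsub>pc.R\<^esub> n"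
  proof (intro bexI ballI)
    show "perfect_closure_code ?X \<in> carrier pc.R" using Xmem by simp
    fix z assume z: "z \<in> carrier pc.R - {\<zero>\<^bsub>pc.R\<^esub>} - Units pc.R"
    then obtain y where y: "z = perfect_closure_code y" "y \<in> perfect_closure" "y \<noteq> 0"
      by (auto simp: pc.carrier_copy)
    have "y \<in> pc_nonunits" using z y(1,2) unfolding pc.Units_copy pc_nonunits_def by blast
    obtain n f where f: "y ^ (2 ^ n) = fps_ac f" using y(2) by (auto simp: perfect_closure_def)
    have "fps_nth f 0 = 0" using pc_nonunits_iff[OF f] \<open>y \<in> pc_nonunits\<close> by simp
    have "f \<noteq> 0" using f y(3) by auto
    define k where "k = subdegree f"
    define u where "u = fps_ac (fps_shift k f)"
    have "k > 0" using \<open>f \<noteq> 0\<close> \<open>fps_nth f 0 = 0\<close> unfolding k_def by (metis gr0I subdegree_eq_0_iff)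
    have "f = fps_shift k f * fps_X ^ k" unfolding k_def by (rule subdegree_decompose)
    then have eq: "y ^ (2 ^ n) = u * ?X ^ k" using f u_def by (metis fps_ac_simps(4,5))
    have "u ^ (2 ^ 0) = fps_ac (fps_shift k f)" by (simp add: u_def)
    moreover have "fps_nth (fps_shift k f) 0 \<noteq> 0" using \<open>f \<noteq> 0\<close> by (simp add: k_def)
    ultimately have "\<exists>d\<in>perfect_closure. u * d = 1" using perfect_closure_unit_iff by blast
    moreover have umem: "u \<in> perfect_closure" unfolding u_def by (rule fps_ac_mem)
    ultimately have U: "perfect_closure_code u \<in> Units pc.R" unfolding pc.Units_copy by blast
    have "z [^]\<^bsub>pc.R\<^esub> ((2::nat) ^ n) = perfect_closure_code u \<otimes>\<^bsub>pc.R\<^esub> perfect_closure_code ?X [^]\<^bsub>pc.R\<^esub> k"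
      using y(1,2) umem Xmem eq by simp
    then show "\<exists>(m::nat) (n::nat). \<exists>u\<in>Units pc.R. m > 0 \<and> n > 0 \<and> z [^]\<^bsub>pc.R\<^esub> m = u \<otimes>\<^bsub>pc.R\<^esub> perfect_closure_code ?X [^]\<^bsub>pc.R\<^esub> n"
      using U \<open>k > 0\<close> by (intro exI[of _ "(2::nat) ^ n"] exI[of _ k] bexI[of _ "perfect_closure_code u"] conjI) simp_all
  qed
qed

text \<open>Each nonunit is the square of a nonunit, so by induction the maximal ideal lies in all
  of its powers.\<close>

lemma nonunits_subset_pow: "perfect_closure_code ` pc_nonunits \<subseteq> ideal_pow pc.R (perfect_closure_code ` pc_nonunits) n"
proof (induction n)
  case 0
  then show ?case by (auto simp: pc_nonunits_def)
next
  case (Suc n)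
  show ?case
  proof
    fix x assume "x \<in> perfect_closure_code ` pc_nonunits"
    then obtain y where y: "x = perfect_closure_code y" "y \<in> pc_nonunits" by blast
    then obtain m f where f: "y ^ (2 ^ m) = fps_ac f" by (auto simp: pc_nonunits_def perfect_closure_def)
    obtain z where z: "z ^ 2 = y" using nth_root_exists[of 2 y] by auto
    \<comment> \<open>The square root belongs to the same power series as \<open>y\<close>, one
      Frobenius step further up, so it stays in the ring and stays a nonunit.\<close>
    then have "z ^ (2 ^ Suc m) = fps_ac f" using f by (simp add: power_mult)
    then have zN: "z \<in> pc_nonunits" using f y(2) pc_nonunits_iff by blast
    then have "z \<in> perfect_closure" by (simp add: pc_nonunits_def)
    then have "x = perfect_closure_code z \<otimes>\<^bsub>pc.R\<^esub> perfect_closure_code z"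
      using z y(1) by (simp add: power2_eq_square)
    also have "\<dots> \<in> ideal_prod pc.R (perfect_closure_code ` pc_nonunits) (ideal_pow pc.R (perfect_closure_code ` pc_nonunits) n)"
      using zN Suc by (intro ideal_prod.prod) auto
    finally show "x \<in> ideal_pow pc.R (perfect_closure_code ` pc_nonunits) (Suc n)" by simp
  qed
qed

lemma not_cond5_pc: "\<not> cond5 pc.R"
proof
  assume "cond5 pc.R"
  then have eq: "(\<Inter>n\<in>{1..}. ideal_pow pc.R (perfect_closure_code ` pc_nonunits) n) = {\<zero>\<^bsub>pc.R\<^esub>}"
    unfolding cond5_def qmax_pc by blast
  have "perfect_closure_code (fps_ac fps_X) \<in> (\<Inter>n\<in>{1..}. ideal_pow pc.R (perfect_closure_code ` pc_nonunits) n)"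
    using nonunits_subset_pow pc_X_nonunit by blast
  then have "fps_ac fps_X = 0" unfolding eq using fps_ac_mem by simp
  then show False by simp
qed

section \<open>An algebraic extension of degree two and unbounded exponent\<close>

definition fls_code :: "'l::{countable,zero} fls \<Rightarrow> nat set set" where
  "fls_code f = {range (\<lambda>i. to_nat (i, fls_nth f i))}"

lemma inv_fls_code: "inv_into UNIV fls_code (fls_code f) = (f :: 'l::{countable,zero} fls)"
proof (rule inv_f_f, rule injI)
  fix f g :: "'l::{countable,zero} fls"
  assume "fls_code f = fls_code g"
  then have "fls_nth f = fls_nth g"
    unfolding fls_code_def by (rule injD[OF inj_graph])
  then show "f = g" by (simp add: fls_eq_iff)
qed

section \<open>Fixed points of Frobenius powers in the algebraic closure of F_2\<close>

lemma two_eq_0_bit_ac: "(2 :: bit alg_closure) = 0"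
  using to_ac_numeral[of "num.Bit0 num.One", where 'a = bit] by (simp only: bit_2_eq_0 to_ac_0)

lemma double_bit_ac: "x + x = (0 :: bit alg_closure)"
  using uminus_eq_self[OF two_eq_0_bit_ac, of x] by (metis add.right_inverse)

lemmas add_frob = add_power_two_power[OF two_eq_0_bit_ac]

lemma frob_fixed_mult:
  fixes z :: "'a::comm_monoid_mult"
  assumes "z ^ (2 ^ m) = z"
  shows "z ^ (2 ^ (m * j)) = z"
proof (induction j)
  case (Suc j)
  have "z ^ (2 ^ (m * Suc j)) = (z ^ (2 ^ m)) ^ (2 ^ (m * j))"
    by (simp add: power_add flip: power_mult)
  then show ?case using Suc assms by simp
qed simp

text \<open>The union over odd \<open>m\<close> of the fields with \<open>2 ^ (d * m)\<close>
  elements: \<open>d = 1\<close> gives k and \<open>d = 2\<close> gives L.\<close>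

definition odd_fixed :: "nat \<Rightarrow> bit alg_closure set" where
  "odd_fixed d = {z. \<exists>m. odd m \<and> z ^ (2 ^ (d * m)) = z}"

text \<open>The product of two odd exponents is odd, so two elements always lie in a common finite
  field, where closure properties can be checked.\<close>

lemma odd_fixed_common:
  assumes "x \<in> odd_fixed d" "y \<in> odd_fixed d"
  obtains m where "odd m" "x ^ (2 ^ (d * m)) = x" "y ^ (2 ^ (d * m)) = y"
proof -
  obtain m n where "odd m" "x ^ (2 ^ (d * m)) = x" "odd n" "y ^ (2 ^ (d * n)) = y"
    using assms by (auto simp: odd_fixed_def)
  then show ?thesis
    using that[of "m * n"] frob_fixed_mult[of x "d * m" n] frob_fixed_mult[of y "d * n" m]
    by (simp add: mult_ac)
qed

lemma odd_fixed_zero: "0 \<in> odd_fixed d" and odd_fixed_one: "1 \<in> odd_fixed d"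
  unfolding odd_fixed_def by (auto intro: exI[of _ 1])

lemma odd_fixed_add: "x \<in> odd_fixed d \<Longrightarrow> y \<in> odd_fixed d \<Longrightarrow> x + y \<in> odd_fixed d"
  by (erule (1) odd_fixed_common) (auto simp: odd_fixed_def add_frob)

lemma odd_fixed_mult: "x \<in> odd_fixed d \<Longrightarrow> y \<in> odd_fixed d \<Longrightarrow> x * y \<in> odd_fixed d"
  by (erule (1) odd_fixed_common) (auto simp: odd_fixed_def power_mult_distrib)

lemma odd_fixed_uminus: "x \<in> odd_fixed d \<Longrightarrow> - x \<in> odd_fixed d"
  by (simp add: uminus_eq_self[OF two_eq_0_bit_ac])

lemma odd_fixed_inverse: "x \<in> odd_fixed d \<Longrightarrow> inverse x \<in> odd_fixed d"
  unfolding odd_fixed_def by (auto simp: power_inverse)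

lemma odd_fixed_1_subset: "odd_fixed 1 \<subseteq> odd_fixed 2"
  unfolding odd_fixed_def using frob_fixed_mult by (fastforce simp: mult.commute)

lemma finite_frob_fixed:
  assumes "m > 0"
  shows "finite {z :: bit alg_closure. z ^ (2 ^ m) = z}"
proof -
  let ?p = "monom 1 (2 ^ m) - monom 1 1 :: bit alg_closure poly"
  have "(2::nat) ^ m > 1" using assms by (intro one_less_power) simp_all
  then have "coeff ?p (2 ^ m) = 1" by simp
  then have "?p \<noteq> 0" by (metis coeff_0 zero_neq_one)
  then have "finite {z. poly ?p z = 0}" by (rule poly_roots_finite)
  then show ?thesis by (simp add: poly_monom)
qed

text \<open>The polynomial T^(2^m) - T splits and has derivative -1, so its roots are
  distinct.\<close>

lemma card_frob_fixed:
  assumes "m > 0"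
  shows "2 ^ m \<le> card {z :: bit alg_closure. z ^ (2 ^ m) = z}"
proof -
  let ?p = "monom 1 (2 ^ m) - monom 1 1 :: bit alg_closure poly"
  have two: "(2::nat) ^ m > 1" using assms by (intro one_less_power) simp_all
  have coeff: "coeff ?p (2 ^ m) = 1" using two by simp
  then have nz: "?p \<noteq> 0" by (metis coeff_0 zero_neq_one)
  have "2 ^ m \<le> degree ?p" using coeff by (intro le_degree) simp
  have "(of_nat (2 ^ m) :: bit alg_closure) = 0" using assms by (simp add: two_eq_0_bit_ac power_0_left)
  then have pd: "pderiv ?p = - 1"
    by (simp add: pderiv_diff pderiv_monom del: of_nat_power)
  obtain A where A: "size A = degree ?p" "?p = smult (lead_coeff ?p) (\<Prod>x\<in>#A. [:- x, 1:])"
    using alg_closed_imp_factorization[OF nz] by auto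
  \<comment> \<open>A repeated root would also be a root of the derivative.\<close>
  have count: "count A x \<le> 1" for x
  proof (rule ccontr)
    assume "\<not> count A x \<le> 1"
    then have "{#x, x#} \<subseteq># A" by (simp add: insert_subset_eq_iff flip: count_greater_zero_iff)
    then obtain B where "A = {#x, x#} + B" by (metis subset_mset.add_diff_inverse)
    then have "?p = [:- x, 1:] * ([:- x, 1:] * smult (lead_coeff ?p) (\<Prod>x\<in>#B. [:- x, 1:]))"
      using A(2) by (simp add: mult.assoc)
    then obtain q where "?p = [:- x, 1:] * ([:- x, 1:] * q)" by blast
    then have "poly (pderiv ?p) x = 0"
      by (simp only: pderiv_mult poly_mult poly_add) simp
    then show False unfolding pd by simp
  qed
  then have "A = mset_set (set_mset A)"
    by (intro multiset_eqI) (metis count_mset_set(1,3) count_eq_zero_iff finite_set_mset le_neq_implies_less less_one)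
  then have "size A = card (set_mset A)" by (metis size_mset_set)
  also have "\<dots> \<le> card {z :: bit alg_closure. z ^ (2 ^ m) = z}"
  proof (rule card_mono[OF finite_frob_fixed[OF assms]], safe)
    fix z assume "z \<in># A"
    then obtain B where "A = add_mset z B" by (metis insert_DiffM)
    then have "?p = [:- z, 1:] * smult (lead_coeff ?p) (\<Prod>x\<in>#B. [:- x, 1:])"
      using A(2) by simp
    then obtain q where "?p = [:- z, 1:] * q" by blast
    then have "poly ?p z = 0" by (simp only: poly_mult) simp
    then show "z ^ (2 ^ m) = z" by (simp add: poly_monom)
  qed
  finally show ?thesis using A(1) \<open>2 ^ m \<le> degree ?p\<close> by simp
qed

lemma infinite_odd_fixed_1: "infinite (odd_fixed 1)"
proof
  assume fin: "finite (odd_fixed 1)"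
  \<comment> \<open>Odd, and so large that a field with \<open>2 ^ ?m\<close> elements cannot
    fit.\<close>
  let ?m = "2 * card (odd_fixed 1) + 1"
  have "{z. z ^ (2 ^ ?m) = z} \<subseteq> odd_fixed 1"
    by (auto simp: odd_fixed_def intro!: exI[of _ ?m])
  then have "card {z :: bit alg_closure. z ^ (2 ^ ?m) = z} \<le> card (odd_fixed 1)"
    by (rule card_mono[OF fin])
  moreover have "?m < 2 ^ ?m" by (rule less_exp)
  ultimately show False using card_frob_fixed[of ?m] by simp
qed

section \<open>A cube root of unity and the extension of degree two\<close>

lemma omega_exists: "\<exists>w :: bit alg_closure. w ^ 2 = w + 1"
proof -
  have "degree [:1, 1, 1 :: bit alg_closure:] > 0" by simp
  then obtain w where "poly [:1, 1, 1 :: bit alg_closure:] w = 0"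
    using alg_closed_imp_poly_has_root by blast
  then have "w ^ 2 + (w + 1) = 0" by (simp add: power2_eq_square algebra_simps)
  then have "- (w + 1) = w ^ 2" by (metis add.commute minus_unique)
  then show ?thesis by (metis uminus_eq_self[OF two_eq_0_bit_ac])
qed

text \<open>In characteristic 2 this is a primitive cube root of unity, a root of T^2 + T +
  1.\<close>

definition omega :: "bit alg_closure" where
  "omega = (SOME w. w ^ 2 = w + 1)"

lemma omega_square: "omega ^ 2 = omega + 1"
  unfolding omega_def using omega_exists by (rule someI_ex)

text \<open>Squaring exchanges \<open>omega\<close> and \<open>omega + 1\<close>, so its even
  iterates fix \<open>omega\<close> and its odd iterates move it.\<close>

lemma omega_frob:
  assumes "odd m"
  shows "omega ^ (2 ^ m) = omega + 1"
proof -
  obtain j where j: "m = 2 * j + 1" using assms by (elim oddE)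
  have "omega ^ (2 ^ 2) = (omega ^ 2) ^ 2" by simp
  also have "\<dots> = omega"
    using add_frob[of omega 1 1] by (simp add: omega_square double_bit_ac add.assoc)
  finally have "omega ^ (2 ^ (2 * j)) = omega" by (rule frob_fixed_mult)
  moreover have "omega ^ (2 ^ m) = (omega ^ (2 ^ (2 * j))) ^ 2"
    by (simp add: j mult.commute flip: power_mult)
  ultimately show ?thesis by (simp only: omega_square)
qed

lemma omega_notin: "omega \<notin> odd_fixed 1"
  by (auto simp: odd_fixed_def omega_frob)

lemma omega_mem: "omega \<in> odd_fixed 2"
proof -
  have "omega ^ (2 ^ (2 * 1)) = (omega ^ (2 ^ 1)) ^ (2 ^ 1)" by simp
  also have "\<dots> = omega"
    using add_frob[of omega 1 1] by (simp add: omega_square double_bit_ac add.assoc)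
  finally show ?thesis unfolding odd_fixed_def by (intro CollectI exI[of _ 1]) auto
qed

text \<open>On the field with 4^m elements the \<open>m\<close>-th Frobenius power is an involution.
  The coefficient \<open>b\<close> is the trace of \<open>z\<close>; as \<open>omega\<close> moves
  to \<open>omega + 1\<close>, adding \<open>b * omega\<close> to \<open>z\<close> gives a fixed
  element.\<close>

lemma odd_fixed_2_decompose:
  assumes "z \<in> odd_fixed 2"
  obtains a b where "a \<in> odd_fixed 1" "b \<in> odd_fixed 1" "z = a + b * omega"
proof -
  obtain m where m: "odd m" "z ^ (2 ^ (2 * m)) = z" using assms by (auto simp: odd_fixed_def)
  have sig: "(z ^ (2 ^ m)) ^ (2 ^ m) = z"
    using m(2) by (simp add: power_add mult_2 flip: power_mult)
  define b where "b = z + z ^ (2 ^ m)"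
  define a where "a = z + b * omega"
  have b: "b ^ (2 ^ m) = b" by (simp add: b_def add_frob sig add.commute)
  have "a ^ (2 ^ m) = z ^ (2 ^ m) + b * (omega + 1)"
    using m(1) b by (simp add: a_def add_frob power_mult_distrib omega_frob)
  also have "\<dots> = b * omega + z + (z ^ (2 ^ m) + z ^ (2 ^ m))"
    unfolding b_def by (simp add: algebra_simps)
  also have "\<dots> = a" by (simp add: double_bit_ac a_def add.commute)
  finally have "a ^ (2 ^ m) = a" .
  moreover have "z = a + b * omega" by (simp add: a_def double_bit_ac add.assoc)
  ultimately show ?thesis using that[of a b] b m(1) by (auto simp: odd_fixed_def)
qed

lemma odd_fixed_2_basis:
  assumes "c \<in> odd_fixed 2" "c \<notin> odd_fixed 1" "d \<in> odd_fixed 2"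
  shows "\<exists>a\<in>odd_fixed 1. \<exists>b\<in>odd_fixed 1. d = a + b * c"
proof -
  obtain a b where ab: "a \<in> odd_fixed 1" "b \<in> odd_fixed 1" "c = a + b * omega"
    using odd_fixed_2_decompose[OF assms(1)] .
  obtain a' b' where ab': "a' \<in> odd_fixed 1" "b' \<in> odd_fixed 1" "d = a' + b' * omega"
    using odd_fixed_2_decompose[OF assms(3)] .
  have "b \<noteq> 0" using ab assms(2) by auto
  \<comment> \<open>Solve \<open>c = a + b * omega\<close> for \<open>omega\<close> and substitute
    in \<open>d\<close>.\<close>
  then have "d = (a' + - (b' * inverse b * a)) + (b' * inverse b) * c"
    unfolding ab(3) ab'(3) by (simp add: field_simps)
  moreover have "b' * inverse b \<in> odd_fixed 1" using ab ab' by (intro odd_fixed_mult odd_fixed_inverse)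
  moreover have "a' + - (b' * inverse b * a) \<in> odd_fixed 1"
    using ab ab' by (intro odd_fixed_add odd_fixed_uminus odd_fixed_mult odd_fixed_inverse)
  ultimately show ?thesis by blast
qed

text \<open>Cancelling \<open>u\<close> in u^(4^m) = u leaves the exponent 4^m - 1.\<close>

lemma odd_fixed_2_torsion:
  assumes "u \<in> odd_fixed 2" "u \<noteq> 0"
  shows "\<exists>n>0. u ^ n = 1"
proof -
  obtain m where m: "odd m" "u ^ (2 ^ (2 * m)) = u" using assms by (auto simp: odd_fixed_def)
  have "m > 0" using m(1) by (rule odd_pos)
  then have gt: "(1::nat) < 2 ^ (2 * m)" by (intro one_less_power) simp_all
  then have "u * u ^ (2 ^ (2 * m) - 1) = u * 1"
    using m(2) by (simp flip: power_Suc)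
  then have "u ^ (2 ^ (2 * m) - 1) = 1" using assms(2) by (metis mult_left_cancel)
  then show ?thesis using gt by (intro exI[of _ "2 ^ (2 * m) - 1"]) simp
qed

text \<open>A common exponent \<open>n\<close> would make \<open>omega + c\<close>, for each of the
  infinitely many \<open>c\<close> in k, a root of the nonzero polynomial (T + 1)^n - T^n.\<close>

lemma odd_fixed_unbounded:
  assumes "n > 0"
  shows "\<exists>u\<in>odd_fixed 2. u \<noteq> 0 \<and> u ^ n \<notin> odd_fixed 1"
proof (rule ccontr)
  assume neg: "\<not> ?thesis"
  let ?p = "[:1, 1:] ^ n - [:0, 1:] ^ n :: bit alg_closure poly"
  have "poly ?p 0 = 1" using assms by (simp add: poly_power power_0_left)
  then have "?p \<noteq> 0" by (metis poly_0 zero_neq_one)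
  then have fin: "finite {x. poly ?p x = 0}" by (rule poly_roots_finite)
  have "poly ?p (omega + c) = 0" if c: "c \<in> odd_fixed 1" for c
  proof -
    have "omega + c \<in> odd_fixed 2"
      using c odd_fixed_1_subset omega_mem odd_fixed_add by blast
    moreover have "omega + c \<noteq> 0"
      using c omega_notin odd_fixed_uminus by (metis add.inverse_inverse minus_unique)
    ultimately have "(omega + c) ^ n \<in> odd_fixed 1" using neg by blast
    \<comment> \<open>One Frobenius power fixes both \<open>c\<close> and the \<open>n\<close>-th
      power, while its odd exponent makes it move \<open>omega\<close>.\<close>
    then obtain m where m: "odd m" "((omega + c) ^ n) ^ (2 ^ (1 * m)) = (omega + c) ^ n" "c ^ (2 ^ (1 * m)) = c"
      by (rule odd_fixed_common[OF _ c])
    have "((omega + c) ^ n) ^ (2 ^ m) = ((omega + c) ^ (2 ^ m)) ^ n"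
      by (simp add: mult.commute flip: power_mult)
    also have "(omega + c) ^ (2 ^ m) = 1 + (omega + c)"
      using m by (simp add: add_frob omega_frob)
    finally show ?thesis using m(2) by (simp add: poly_power)
  qed
  then have "(\<lambda>c. omega + c) ` odd_fixed 1 \<subseteq> {x. poly ?p x = 0}" by blast
  then have "finite ((\<lambda>c. omega + c) ` odd_fixed 1)" using fin by (rule finite_subset)
  then have "finite (odd_fixed 1)" by (rule finite_imageD) (simp add: inj_on_def)
  then show False using infinite_odd_fixed_1 by simp
qed

section \<open>The extension as a countable field type\<close>

lemma countable_odd_fixed_2: "countable (odd_fixed 2)"
proof -
  have "odd_fixed 2 = (\<Union>m\<in>{m. odd m}. {z. z ^ (2 ^ (2 * m)) = z})"
    by (auto simp: odd_fixed_def)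
  moreover have "countable \<dots>"
  proof (rule countable_UN)
    fix m :: nat assume "m \<in> {m. odd m}"
    then have "2 * m > 0" by (auto intro: odd_pos)
    then show "countable {z :: bit alg_closure. z ^ (2 ^ (2 * m)) = z}" by (intro countable_finite finite_frob_fixed)
  qed simp
  ultimately show ?thesis by simp
qed

text \<open>Laurent series take their coefficients from a type, so L is made one, while k stays a
  subset of it. Its countability makes \<open>fls_code\<close> applicable.\<close>

typedef quadratic_field = "odd_fixed 2"
  using odd_fixed_zero by blast

setup_lifting type_definition_quadratic_field

instantiation quadratic_field :: field
begin

lift_definition zero_quadratic_field :: quadratic_field is 0 by (rule odd_fixed_zero)
lift_definition one_quadratic_field :: quadratic_field is 1 by (rule odd_fixed_one)
lift_definition plus_quadratic_field :: "quadratic_field \<Rightarrow> quadratic_field \<Rightarrow> quadratic_field" is "(+)"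
  by (rule odd_fixed_add)
lift_definition times_quadratic_field :: "quadratic_field \<Rightarrow> quadratic_field \<Rightarrow> quadratic_field" is "(*)"
  by (rule odd_fixed_mult)
lift_definition uminus_quadratic_field :: "quadratic_field \<Rightarrow> quadratic_field" is uminus
  by (rule odd_fixed_uminus)
lift_definition inverse_quadratic_field :: "quadratic_field \<Rightarrow> quadratic_field" is inverse
  by (rule odd_fixed_inverse)
definition minus_quadratic_field :: "quadratic_field \<Rightarrow> quadratic_field \<Rightarrow> quadratic_field" where
  "minus_quadratic_field x y = x + - y"
definition divide_quadratic_field :: "quadratic_field \<Rightarrow> quadratic_field \<Rightarrow> quadratic_field" where
  "divide_quadratic_field x y = x * inverse y"

instance
  by standard
    (simp_all add: minus_quadratic_field_def divide_quadratic_field_def, (transfer; simp add: algebra_simps)+)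

end

instance quadratic_field :: countable
proof
  have "inj (\<lambda>x. to_nat_on (odd_fixed 2) (Rep_quadratic_field x))"
    using inj_on_to_nat_on[OF countable_odd_fixed_2] Rep_quadratic_field
    by (intro injI Rep_quadratic_field_inject[THEN iffD1]) (auto dest: inj_onD)
  then show "\<exists>to_nat :: quadratic_field \<Rightarrow> nat. inj to_nat" by blast
qed

lemma Rep_quadratic_field_power: "Rep_quadratic_field (x ^ n) = Rep_quadratic_field x ^ n"
  by (induction n) (simp_all add: one_quadratic_field.rep_eq times_quadratic_field.rep_eq)

definition quadratic_base :: "quadratic_field set" where
  "quadratic_base = {x. Rep_quadratic_field x \<in> odd_fixed 1}"

interpretation quad: residue_subfield quadratic_base fls_code "inv_into UNIV fls_code"
  by unfold_locales
    (auto simp: quadratic_base_def inv_fls_code zero_quadratic_field.rep_eq one_quadratic_field.rep_eq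
       plus_quadratic_field.rep_eq times_quadratic_field.rep_eq uminus_quadratic_field.rep_eq
       inverse_quadratic_field.rep_eq odd_fixed_zero odd_fixed_one
       intro: odd_fixed_add odd_fixed_mult odd_fixed_uminus odd_fixed_inverse)

lemma quad_torsion:
  assumes "u \<noteq> 0"
  shows "\<exists>n>0. u ^ n \<in> quadratic_base"
proof -
  have "Rep_quadratic_field u \<noteq> 0"
    using assms by (metis Rep_quadratic_field_inject zero_quadratic_field.rep_eq)
  then obtain n where "n > 0" "Rep_quadratic_field u ^ n = 1"
    using odd_fixed_2_torsion Rep_quadratic_field by blast
  then show ?thesis
    by (auto simp: quadratic_base_def Rep_quadratic_field_power odd_fixed_one intro!: exI[of _ n])
qed

lemma cond2_quad: "cond2 quad.R"
  unfolding cond2_def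
proof
  show "AV_domain quad.R" by (rule quad.AV_domain_R) (rule quad_torsion)
  show "noetherian_ring quad.R"
  proof (rule quad.noetherian_R)
    fix c d assume "c \<notin> quadratic_base"
    then have "\<exists>a\<in>odd_fixed 1. \<exists>b\<in>odd_fixed 1. Rep_quadratic_field d = a + b * Rep_quadratic_field c"
      by (intro odd_fixed_2_basis) (auto simp: quadratic_base_def Rep_quadratic_field)
    then obtain a b where ab: "a \<in> odd_fixed 1" "b \<in> odd_fixed 1" "Rep_quadratic_field d = a + b * Rep_quadratic_field c"
      by blast
    then have Rep: "Rep_quadratic_field (Abs_quadratic_field a) = a" "Rep_quadratic_field (Abs_quadratic_field b) = b"
      using odd_fixed_1_subset by (auto intro!: Abs_quadratic_field_inverse)
    then have "d = Abs_quadratic_field a + Abs_quadratic_field b * c"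
      using ab(3) by (intro Rep_quadratic_field_inject[THEN iffD1])
        (simp add: plus_quadratic_field.rep_eq times_quadratic_field.rep_eq)
    then show "\<exists>a\<in>quadratic_base. \<exists>b\<in>quadratic_base. d = a + b * c"
      using ab Rep by (intro bexI[of _ "Abs_quadratic_field a"] bexI[of _ "Abs_quadratic_field b"])
        (auto simp: quadratic_base_def)
  qed
qed

lemma not_cond6_quad: "\<not> cond6 quad.R"
proof
  assume "cond6 quad.R"
  then have "API_domain quad.R" by (simp add: cond6_def)
  then obtain n where n: "n > 0" "\<And>u. u \<noteq> 0 \<Longrightarrow> u ^ n \<in> quadratic_base"
    by (rule quad.API_imp_bounded_exponent) blast
  obtain u where u: "u \<in> odd_fixed 2" "u \<noteq> 0" "u ^ n \<notin> odd_fixed 1"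
    using odd_fixed_unbounded[OF n(1)] by blast
  have Rep: "Rep_quadratic_field (Abs_quadratic_field u) = u"
    using u(1) by (rule Abs_quadratic_field_inverse)
  then have "Abs_quadratic_field u \<noteq> 0" using u(2) by (metis zero_quadratic_field.rep_eq)
  then have "Abs_quadratic_field u ^ n \<in> quadratic_base" by (rule n(2))
  then show False using u(3) Rep by (simp add: quadratic_base_def Rep_quadratic_field_power)
qed

section \<open>A purely inseparable extension of infinite degree\<close>

instance poly_mapping :: (countable, "{countable, zero}") countable
proof
  \<comment> \<open>A finitely supported function is recovered from its graph on the support, a
    finite set of pairs.\<close>
  let ?g = "\<lambda>f :: ('a \<Rightarrow>\<^sub>0 'b). (\<lambda>k. (k, Poly_Mapping.lookup f k)) ` Poly_Mapping.keys f"
  have "inj ?g"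
  proof (rule injI)
    fix f h :: "'a \<Rightarrow>\<^sub>0 'b" assume eq: "?g f = ?g h"
    have "Poly_Mapping.keys f = fst ` ?g f" "Poly_Mapping.keys h = fst ` ?g h" by force+
    then have keys: "Poly_Mapping.keys f = Poly_Mapping.keys h" using eq by simp
    have "Poly_Mapping.lookup f k = Poly_Mapping.lookup h k" for k
    proof (cases "k \<in> Poly_Mapping.keys f")
      case True
      then have "(k, Poly_Mapping.lookup f k) \<in> ?g h" using eq by blast
      then show ?thesis by auto
    next
      case False
      then show ?thesis using keys by (metis not_in_keys_iff_lookup_eq_zero)
    qed
    then show "f = h" by (rule poly_mapping_eqI)
  qed
  have "range ?g \<subseteq> {A. finite A}" by auto
  then have "countable (range ?g)" using countable_Collect_finite by (rule countable_subset)
  then have "countable (UNIV :: ('a \<Rightarrow>\<^sub>0 'b) set)"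
    using \<open>inj ?g\<close> by (rule countable_image_inj_on)
  then show "\<exists>to_nat :: ('a \<Rightarrow>\<^sub>0 'b) \<Rightarrow> nat. inj to_nat" by (rule countableE) blast
qed

instance fract :: ("{idom, countable}") countable
proof
  have "range (\<lambda>(a, b). Fract a b :: 'a fract) = UNIV"
  proof (intro equalityI subsetI UNIV_I)
    fix x :: "'a fract"
    show "x \<in> range (\<lambda>(a, b). Fract a b)"
    proof (cases x)
      case (Fract a b)
      then show ?thesis by (intro image_eqI[of _ _ "(a, b)"]) auto
    qed
  qed
  then have "countable (UNIV :: 'a fract set)" by (metis countableI_type countable_image)
  then show "\<exists>to_nat :: 'a fract \<Rightarrow> nat. inj to_nat" by (rule countableE) blast
qed

type_synonym monomials = "nat \<Rightarrow>\<^sub>0 nat"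
type_synonym f2_poly = "monomials \<Rightarrow>\<^sub>0 bit"
type_synonym f2_ratfun = "f2_poly fract"

text \<open>The subring generated by the square of the \<open>i\<close>-th indeterminate and all the
  other indeterminates.\<close>

definition even_in :: "nat \<Rightarrow> f2_poly set" where
  "even_in i = {p. \<forall>g\<in>Poly_Mapping.keys p. even (Poly_Mapping.lookup g i)}"

text \<open>
  \<open>even_ratfun i\<close> is closed under addition and multiplication, contains all squares, misses the
  \<open>i\<close>-th indeterminate, and contains any given rational function for almost all \<open>i\<close>: it plays the role
  of a proper \<open>L\<^sup>2\<close>-subspace around the span of finitely many elements.
\<close>

definition even_ratfun :: "nat \<Rightarrow> f2_ratfun set" where
  "even_ratfun i = {Fract a b | a b. a \<in> even_in i \<and> b \<in> even_in i \<and> b \<noteq> 0}"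

lemma even_ratfunI: "a \<in> even_in i \<Longrightarrow> b \<in> even_in i \<Longrightarrow> b \<noteq> 0 \<Longrightarrow> Fract a b \<in> even_ratfun i"
  unfolding even_ratfun_def by blast

lemma even_in_zero: "0 \<in> even_in i" and even_in_one: "1 \<in> even_in i"
  by (simp_all add: even_in_def)

lemma even_in_add: "p \<in> even_in i \<Longrightarrow> q \<in> even_in i \<Longrightarrow> p + q \<in> even_in i"
  unfolding even_in_def using keys_add[of p q] by blast

lemma even_in_mult: "p \<in> even_in i \<Longrightarrow> q \<in> even_in i \<Longrightarrow> p * q \<in> even_in i"
  unfolding even_in_def using keys_mult[of p q] by (fastforce simp: lookup_add)

lemma two_eq_0_f2_poly: "(2 :: f2_poly) = 0"
proof -
  have "(1 + 1 :: f2_poly) = Poly_Mapping.single 0 (1 + 1)" by (simp only: single_add single_one)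
  then show ?thesis by simp
qed

lemma two_eq_0_f2_ratfun: "(2 :: f2_ratfun) = 0"
proof -
  have "(2 :: f2_ratfun) = Fract 2 1" by (metis of_nat_numeral of_nat_fract)
  then show ?thesis by (simp add: two_eq_0_f2_poly Zero_fract_def)
qed

lemma single_square_even: "(Poly_Mapping.single g c :: f2_poly) ^ 2 \<in> even_in i"
  by (auto simp: power2_eq_square mult_single even_in_def lookup_add split: if_splits)

text \<open>In characteristic 2 the square of a sum is the sum of the squares, so induction on the
  terms reduces to a single one.\<close>

lemma square_even: "(p :: f2_poly) ^ 2 \<in> even_in i"
proof (induction p rule: update_induct)
  case const
  show ?case by (simp add: even_in_zero)
next
  case (update f a b)
  have "Poly_Mapping.update a b f = f + Poly_Mapping.single a b"
    using update(1) by (intro poly_mapping_eqI)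
      (auto simp: lookup_update lookup_add lookup_single in_keys_iff when_def)
  then show ?case using update(3) single_square_even[of a b i]
    by (simp add: power2_sum two_eq_0_f2_poly even_in_add)
qed

lemma even_ratfun_mult: "x \<in> even_ratfun i \<Longrightarrow> y \<in> even_ratfun i \<Longrightarrow> x * y \<in> even_ratfun i"
  unfolding even_ratfun_def by (clarsimp, intro exI conjI, rule refl) (auto intro: even_in_mult)

lemma even_ratfun_add: "x \<in> even_ratfun i \<Longrightarrow> y \<in> even_ratfun i \<Longrightarrow> x + y \<in> even_ratfun i"
  unfolding even_ratfun_def by (clarsimp, intro exI conjI, rule refl) (auto intro: even_in_mult even_in_add)

lemma even_ratfun_zero: "0 \<in> even_ratfun i"
  unfolding Zero_fract_def by (rule even_ratfunI) (simp_all add: even_in_zero even_in_one)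

lemma even_ratfun_square: "x ^ 2 \<in> even_ratfun i"
proof (cases x)
  case (Fract a b)
  then have "x ^ 2 = Fract (a ^ 2) (b ^ 2)" by (simp add: power2_eq_square)
  then show ?thesis using Fract(2) by (simp add: even_ratfunI square_even)
qed

definition indet :: "nat \<Rightarrow> f2_poly" where
  "indet i = Poly_Mapping.single (Poly_Mapping.single i 1) 1"

text \<open>In \<open>indet i * b = a\<close> the exponents of the \<open>i\<close>-th indeterminate
  are odd on the left and even on the right, so both sides vanish.\<close>

lemma indet_notin: "Fract (indet i) 1 \<notin> even_ratfun i"
proof
  assume "Fract (indet i) 1 \<in> even_ratfun i"
  then obtain a b where ab: "a \<in> even_in i" "b \<in> even_in i" "b \<noteq> 0" "Fract (indet i) 1 = Fract a b"
    unfolding even_ratfun_def by blast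
  then have eq: "indet i * b = a" by (simp add: eq_fract)
  have "odd (Poly_Mapping.lookup g i)" if "g \<in> Poly_Mapping.keys (indet i * b)" for g
    using that keys_mult[of "indet i" b] ab(2) by (auto simp: indet_def even_in_def lookup_add)
  then have "Poly_Mapping.keys a = {}" using eq ab(1) by (auto simp: even_in_def)
  then have "a = 0" by simp
  moreover have "Poly_Mapping.lookup (indet i) (Poly_Mapping.single i 1) = 1"
    by (simp add: indet_def)
  then have "indet i \<noteq> 0" by (metis lookup_zero zero_neq_one)
  ultimately show False using eq ab(3) by simp
qed

text \<open>Membership can fail only for an indeterminate that occurs in \<open>p\<close>.\<close>

lemma finite_not_even_in: "finite {i. p \<notin> even_in i}"
proof -
  have "{i. p \<notin> even_in i} \<subseteq> (\<Union>g\<in>Poly_Mapping.keys p. Poly_Mapping.keys g)"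
    by (auto simp: even_in_def in_keys_iff intro!: bexI odd_pos)
  then show ?thesis by (rule finite_subset) simp
qed

lemma finite_not_even_ratfun: "finite {i. x \<notin> even_ratfun i}"
proof (cases x)
  case (Fract a b)
  then have "{i. x \<notin> even_ratfun i} \<subseteq> {i. a \<notin> even_in i} \<union> {i. b \<notin> even_in i}"
    unfolding even_ratfun_def by blast
  then show ?thesis by (rule finite_subset) (simp add: finite_not_even_in)
qed

section \<open>The ring over the subfield of squares\<close>

interpretation sq: residue_subfield "range (\<lambda>x :: f2_ratfun. x ^ 2)" fls_code "inv_into UNIV fls_code"
proof unfold_locales
  show "0 \<in> range (\<lambda>x :: f2_ratfun. x ^ 2)" "1 \<in> range (\<lambda>x :: f2_ratfun. x ^ 2)"
    by (auto simp: image_iff intro: exI[of _ 0] exI[of _ 1])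
  fix a b :: f2_ratfun assume "a \<in> range (\<lambda>x. x ^ 2)" "b \<in> range (\<lambda>x. x ^ 2)"
  then obtain x y where xy: "a = x ^ 2" "b = y ^ 2" by blast
  have "a + b = (x + y) ^ 2" "a * b = (x * y) ^ 2"
    by (simp_all add: xy power2_sum two_eq_0_f2_ratfun power_mult_distrib)
  then show "a + b \<in> range (\<lambda>x. x ^ 2)" "a * b \<in> range (\<lambda>x. x ^ 2)" by blast+
next
  fix a :: f2_ratfun assume a: "a \<in> range (\<lambda>x. x ^ 2)"
  then show "- a \<in> range (\<lambda>x. x ^ 2)" by (simp add: uminus_eq_self[OF two_eq_0_f2_ratfun])
  obtain x where "a = x ^ 2" using a by blast
  then have "inverse a = inverse x ^ 2" by (simp add: power_inverse)
  then show "inverse a \<in> range (\<lambda>x. x ^ 2)" by blast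
qed (rule inv_fls_code)

lemma sq_torsion: "\<exists>n>0. (u :: f2_ratfun) ^ n \<in> range (\<lambda>x. x ^ 2)"
  by (intro exI[of _ 2]) simp

text \<open>Almost every \<open>i\<close> has the whole finite set inside
  \<open>even_ratfun i\<close>, a proper subspace over the squares.\<close>

lemma not_noetherian_sq: "\<not> noetherian_ring sq.R"
proof (rule sq.not_noetherian_R)
  fix F :: "f2_ratfun set" assume "finite F"
  then have "finite (\<Union>x\<in>F. {i. x \<notin> even_ratfun i})" using finite_not_even_ratfun by blast
  then obtain i where i: "i \<notin> (\<Union>x\<in>F. {i. x \<notin> even_ratfun i})"
    using ex_new_if_finite[OF infinite_UNIV_nat] by blast
  have "even_ratfun i \<noteq> UNIV" using indet_notin[of i] by blast
  then show "\<exists>W. F \<subseteq> W \<and> W \<noteq> UNIV \<and> 0 \<in> W \<and> (\<forall>a\<in>W. \<forall>b\<in>W. a + b \<in> W) \<and> 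
      (\<forall>c\<in>range (\<lambda>x. x ^ 2). \<forall>a\<in>W. c * a \<in> W)"
    using i even_ratfun_zero even_ratfun_add even_ratfun_mult even_ratfun_square
    by (intro exI[of _ "even_ratfun i"]) auto
qed

lemma not_cond2_sq: "\<not> cond2 sq.R"
  using not_noetherian_sq by (simp add: cond2_def)

lemma AV_domain_sq: "AV_domain sq.R"
  by (rule sq.AV_domain_R) (rule sq_torsion)

text \<open>All squares lie in the residue field, so 2 is a uniform exponent.\<close>

lemma cond6_sq: "cond6 sq.R"
  unfolding cond6_def using sq.quasilocal_R sq.API_domain_R[of 2] by simp

lemma cond4_sq: "cond4 sq.R"
  by (rule sq.cond4_R) (rule sq_torsion)

theorem theorem12:
  shows "(\<exists>R :: nat set set ring. quasilocal R \<and> cond2 R \<and> \<not> cond6 R) \<and>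
         (\<exists>R :: nat set set ring. quasilocal R \<and> cond6 R \<and> \<not> cond2 R) \<and>
         (\<exists>R :: nat set set ring. quasilocal R \<and> cond3 R \<and> \<not> cond2 R) \<and>
         (\<exists>R :: nat set set ring. quasilocal R \<and> cond4 R \<and> \<not> cond2 R) \<and>
         (\<exists>R :: nat set set ring. quasilocal R \<and> cond7 R \<and> \<not> cond5 R)"
  using quad.quasilocal_R cond2_quad not_cond6_quad
    sq.quasilocal_R cond6_sq not_cond2_sq sq.cond3_R[OF AV_domain_sq] cond4_sq
    quasilocal_pc cond7_pc not_cond5_pc
  by (intro conjI exI)

end
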